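(* Let $T$ be a tree with at least one edge and with a vertex $c$ such that every vertex of $T$ is at distance at most $2$ from $c$. Let $B=\deg_T(c)$, let $L_1$ be the number of leaves of $T$ adjacent to $c$, let $m=B-L_1$ be the number of neighbors of $c$ having degree at least $2$, and let $L_2$ be the number of vertices at distance exactly $2$ from $c$. Then $$\deg h_{R_T/J(T)}(t)=\begin{cases} B-1, & \text{if } L_2=0,\\ B+L_2-1, & \text{if } L_1=0,\\ m+\max\{L_1,L_2\}-1, & \text{if } L_1>0 \text{ and } L_1\neq L_2,\\ B-1, & \text{if } L_1=L_2>0 \text{ and } m \text{ is odd},\\ B-2, & \text{if } L_1=L_2>0 \text{ and } m \text{ is even}. \end{cases}$$
   Context: $\Bbbk$ is a field and $R_T=\Bbbk[x_v:v\in V(T)]$ with the standard grading. The cover ideal is $J(T)=\bigl(\prod_{v\in W}x_v : W \text{ a minimal vertex cover of } T\bigr)=\bigcap_{\{u,v\}\in E(T)}(x_u,x_v)$. For a standard graded $\Bbbk$-algebra $A$ with Hilbert series $H_A(t)$, the $h$-polynomial $h_A(t)\in\mathbb{Z}[t]$ is the unique polynomial with $H_A(t)=h_A(t)/(1-t)^{\dim A}$. *)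

theory Defs
  imports
    "HOL-Library.Poly_Mapping"
    "HOL-Library.Extended_Nat"
    "HOL-Computational_Algebra.Polynomial_FPS"
    "HOL-Algebra.QuotRing"
    "HOL-Algebra.Embedded_Algebras"
begin

section \<open>Finite simple graphs and trees\<close>

text \<open>A graph is given by its vertex set and its set of two-element edges. The trees of
  the AFP entry \<open>Graph_Theory\<close> are directed (their cycles may have length 2), so they do not
  model undirected trees.\<close>

definition simple_graph :: "'v set \<Rightarrow> 'v set set \<Rightarrow> bool" where
  "simple_graph V E \<longleftrightarrow> finite V \<and> (\<forall>e\<in>E. \<exists>u\<in>V. \<exists>v\<in>V. u \<noteq> v \<and> e = {u, v})"

definition neighbors :: "'v set \<Rightarrow> 'v set set \<Rightarrow> 'v \<Rightarrow> 'v set" where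
  "neighbors V E u = {v \<in> V. {u, v} \<in> E}"

definition graph_degree :: "'v set \<Rightarrow> 'v set set \<Rightarrow> 'v \<Rightarrow> nat" where
  "graph_degree V E u = card (neighbors V E u)"

definition is_leaf :: "'v set \<Rightarrow> 'v set set \<Rightarrow> 'v \<Rightarrow> bool" where
  "is_leaf V E u \<longleftrightarrow> u \<in> V \<and> graph_degree V E u = 1"

text \<open>A walk is the list of its vertices; it has one edge fewer than vertices.\<close>

definition walk :: "'v set \<Rightarrow> 'v set set \<Rightarrow> 'v \<Rightarrow> 'v list \<Rightarrow> 'v \<Rightarrow> bool" where
  "walk V E u p v \<longleftrightarrow> p \<noteq> [] \<and> hd p = u \<and> last p = v \<and> set p \<subseteq> V \<and>
     successively (\<lambda>x y. {x, y} \<in> E) p"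

definition connected_graph :: "'v set \<Rightarrow> 'v set set \<Rightarrow> bool" where
  "connected_graph V E \<longleftrightarrow> V \<noteq> {} \<and> (\<forall>u\<in>V. \<forall>v\<in>V. \<exists>p. walk V E u p v)"

definition graph_cycle :: "'v set \<Rightarrow> 'v set set \<Rightarrow> 'v list \<Rightarrow> bool" where
  "graph_cycle V E p \<longleftrightarrow> length p \<ge> 3 \<and> distinct p \<and> walk V E (hd p) p (last p) \<and>
     {last p, hd p} \<in> E"

definition is_tree :: "'v set \<Rightarrow> 'v set set \<Rightarrow> bool" where
  "is_tree V E \<longleftrightarrow> simple_graph V E \<and> connected_graph V E \<and> (\<nexists>p. graph_cycle V E p)"

text \<open>Only meaningful if some walk joins \<open>u\<close> and \<open>v\<close>.\<close>

definition graph_dist :: "'v set \<Rightarrow> 'v set set \<Rightarrow> 'v \<Rightarrow> 'v \<Rightarrow> nat" where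
  "graph_dist V E u v = (LEAST n. \<exists>p. walk V E u p v \<and> length p = Suc n)"

definition vertex_cover :: "'v set \<Rightarrow> 'v set set \<Rightarrow> 'v set \<Rightarrow> bool" where
  "vertex_cover V E W \<longleftrightarrow> W \<subseteq> V \<and> (\<forall>e\<in>E. W \<inter> e \<noteq> {})"

definition minimal_vertex_cover :: "'v set \<Rightarrow> 'v set set \<Rightarrow> 'v set \<Rightarrow> bool" where
  "minimal_vertex_cover V E W \<longleftrightarrow>
     vertex_cover V E W \<and> (\<forall>W'. W' \<subset> W \<longrightarrow> \<not> vertex_cover V E W')"


section \<open>Polynomial rings and cover ideals\<close>

text \<open>A polynomial is a finitely supported map from monomials (finitely supported exponent
  vectors) to coefficients.\<close>

type_synonym ('v, 'k) mpoly = "('v \<Rightarrow>\<^sub>0 nat) \<Rightarrow>\<^sub>0 'k"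

definition const_poly :: "'k::field \<Rightarrow> ('v, 'k) mpoly" where
  "const_poly a = Poly_Mapping.single 0 a"

definition var_poly :: "'v \<Rightarrow> ('v, 'k::field) mpoly" where
  "var_poly v = Poly_Mapping.single (Poly_Mapping.single v 1) 1"

definition poly_ring :: "'v set \<Rightarrow> ('v, 'k::field) mpoly ring" where
  "poly_ring V =
     \<lparr>carrier = {p. \<forall>a\<in>Poly_Mapping.keys p. Poly_Mapping.keys a \<subseteq> V},
      mult = (*), one = 1, zero = 0, add = (+)\<rparr>"

definition monomial_degree :: "('v \<Rightarrow>\<^sub>0 nat) \<Rightarrow> nat" where
  "monomial_degree a = (\<Sum>v\<in>Poly_Mapping.keys a. Poly_Mapping.lookup a v)"

definition homogeneous_part :: "'v set \<Rightarrow> nat \<Rightarrow> ('v, 'k::field) mpoly set" where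
  "homogeneous_part V d =
     {p \<in> carrier (poly_ring V). \<forall>a\<in>Poly_Mapping.keys p. monomial_degree a = d}"

definition cover_ideal :: "'v set \<Rightarrow> 'v set set \<Rightarrow> ('v, 'k::field) mpoly set" where
  "cover_ideal V E =
     Idl\<^bsub>poly_ring V\<^esub> {\<Prod>v\<in>W. var_poly v | W. minimal_vertex_cover V E W}"


section \<open>Krull dimension, Hilbert series and h-polynomial\<close>

text \<open>The supremum of the lengths of strict chains of prime ideals. The value 0 for the zero
  ring is a convention.\<close>

definition krull_dim :: "('a, 'b) ring_scheme \<Rightarrow> enat" where
  "krull_dim A = Sup {enat n | n. \<exists>P :: nat \<Rightarrow> 'a set.
     (\<forall>i\<le>n. primeideal (P i) A) \<and> (\<forall>i<n. P i \<subset> P (Suc i))}"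

text \<open>In the following, \<open>A\<close> is a graded algebra over its subfield \<open>K\<close>, with graded
  components \<open>G d\<close>.\<close>

definition hilbert_series ::
    "('a, 'b) ring_scheme \<Rightarrow> 'a set \<Rightarrow> (nat \<Rightarrow> 'a set) \<Rightarrow> int fps" where
  "hilbert_series A K G = Abs_fps (\<lambda>d. int (ring.dim A K (G d)))"

text \<open>The equation below is \<open>H = h / (1 - t) ^ dim A\<close> with the denominator, a unit in the ring
  of formal power series, cleared.\<close>

definition h_polynomial ::
    "('a, 'b) ring_scheme \<Rightarrow> 'a set \<Rightarrow> (nat \<Rightarrow> 'a set) \<Rightarrow> int poly" where
  "h_polynomial A K G = (THE h.
     fps_of_poly h = hilbert_series A K G * (1 - fps_X) ^ the_enat (krull_dim A))"

text \<open>The h-polynomial of the quotient of \<open>poly_ring V\<close> by a homogeneous ideal \<open>I\<close>, where the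
  base field and the graded components are images under the quotient map.\<close>

definition quotient_h_polynomial :: "'v set \<Rightarrow> ('v, 'k::field) mpoly set \<Rightarrow> int poly" where
  "quotient_h_polynomial V I =
     h_polynomial (poly_ring V Quot I)
       ((\<lambda>a. I +>\<^bsub>poly_ring V\<^esub> const_poly a) ` UNIV)
       (\<lambda>d. (\<lambda>p. I +>\<^bsub>poly_ring V\<^esub> p) ` homogeneous_part V d)"

end

theory Submission
  imports Defs
begin

text \<open>
  A monomial lies in the cover ideal exactly if its support is a vertex cover, so
  \<open>R/J\<close> has the monomials with non-covering support as a basis. Two things follow.

  The Hilbert series is a sum over the vertex sets \<open>W\<close> that are not covers. The monomials with
  support \<open>W\<close> contribute \<open>(t/(1-t))^|W|\<close>, and as \<open>W\<close> misses both ends of some edge, a denominator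
  \<open>(1-t)^(|V|-2)\<close> is enough. The exponent \<open>|V|-2\<close> is also the Krull dimension: a prime containing the
  ideal contains both variables of some edge, and a polynomial ring in \<open>k\<close> variables has no chain
  of more than \<open>k+1\<close> primes. The latter is shown by algebraic independence
  (\<open>prime_chain_independent\<close>) against a count of exponents (\<open>polynomial_relation_exists\<close>). Therefore
  \<open>h (1-t)^2 = 1 - K\<close>, where \<open>K\<close> is the sum of \<open>t^|W| (1-t)^|V-W|\<close> over all vertex covers \<open>W\<close>
  (\<open>cover_h_polynomial_equation\<close>).

  A tree of radius at most two around \<open>c\<close> consists of the edges from \<open>c\<close> to its neighbors \<open>a\<close> and of
  \<open>s a\<close> pendant edges at each \<open>a\<close>. Reading \<open>t^|W| (1-t)^|V-W|\<close> as the probability of a random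
  vertex set, and distinguishing whether the cover contains \<open>c\<close>, gives
  \<open>K = t * (\<Prod>a. t + (1-t) t^(s a)) + (1-t) t^B\<close> (\<open>sum_vertex_covers_weight\<close>). A leaf \<open>a\<close>
  contributes the factor \<open>1\<close> to the product, so the first summand has degree \<open>L2 + m + 1\<close> and leading
  coefficient \<open>(-1)^m\<close>, while the second has degree \<open>B + 1 = L1 + m + 1\<close> and leading coefficient
  \<open>-1\<close>. They can cancel only if \<open>L1 = L2\<close> and \<open>m\<close> is even; then the next coefficient
  survives, by the sign bound in \<open>star_product_coeffs\<close>.
\<close>

section \<open>Polynomial rings\<close>

lemma poly_ring_simps [simp]:
  "p \<otimes>\<^bsub>poly_ring V\<^esub> q = p * q" "p \<oplus>\<^bsub>poly_ring V\<^esub> q = p + q"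
  "\<one>\<^bsub>poly_ring V\<^esub> = 1" "\<zero>\<^bsub>poly_ring V\<^esub> = 0"
  by (simp_all add: poly_ring_def)

lemma mem_poly_ring:
  "p \<in> carrier (poly_ring V) \<longleftrightarrow> (\<forall>a\<in>Poly_Mapping.keys p. Poly_Mapping.keys a \<subseteq> V)"
  by (simp add: poly_ring_def)

lemma keys_exponent_add:
  fixes a b :: "'v \<Rightarrow>\<^sub>0 nat"
  shows "Poly_Mapping.keys (a + b) = Poly_Mapping.keys a \<union> Poly_Mapping.keys b"
  by (auto simp: in_keys_iff lookup_add)

lemma keys_multE:
  assumes "k \<in> Poly_Mapping.keys (p * q)"
  obtains a b where "a \<in> Poly_Mapping.keys p" "b \<in> Poly_Mapping.keys q" "k = a + b"
  using keys_mult[of p q] assms by blast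

lemma keys_uminus_eq:
  fixes p :: "'a \<Rightarrow>\<^sub>0 'b::ab_group_add"
  shows "Poly_Mapping.keys (- p) = Poly_Mapping.keys p"
  by (auto simp: in_keys_iff)

lemma poly_ring_mult_closed:
  assumes "p \<in> carrier (poly_ring V)" "q \<in> carrier (poly_ring V)"
  shows "p * q \<in> carrier (poly_ring V)"
  unfolding mem_poly_ring
proof
  fix k assume "k \<in> Poly_Mapping.keys (p * q)"
  then obtain a b where "a \<in> Poly_Mapping.keys p" "b \<in> Poly_Mapping.keys q" "k = a + b"
    by (rule keys_multE)
  with assms show "Poly_Mapping.keys k \<subseteq> V"
    by (auto simp: mem_poly_ring keys_exponent_add)
qed

lemma poly_ring_add_closed:
  assumes "p \<in> carrier (poly_ring V)" "q \<in> carrier (poly_ring V)"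
  shows "p + q \<in> carrier (poly_ring V)"
  using assms keys_add[of p q] by (auto simp: mem_poly_ring)

lemma poly_ring_uminus_closed:
  assumes "p \<in> carrier (poly_ring V)"
  shows "- p \<in> carrier (poly_ring V)"
  using assms by (simp add: mem_poly_ring keys_uminus_eq)

lemma poly_ring_const [simp]: "const_poly c \<in> carrier (poly_ring V)"
  by (simp add: mem_poly_ring const_poly_def)

lemma poly_ring_one [simp]: "1 \<in> carrier (poly_ring V)"
  by (simp add: mem_poly_ring)

lemma poly_ring_single:
  "Poly_Mapping.keys a \<subseteq> V \<Longrightarrow> Poly_Mapping.single a c \<in> carrier (poly_ring V)"
  by (simp add: mem_poly_ring)

lemma poly_ring_cring: "cring (poly_ring V :: ('v, 'k::field) mpoly ring)"
proof (rule cringI)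
  show "abelian_group (poly_ring V :: ('v, 'k) mpoly ring)"
  proof (rule abelian_groupI)
    fix x :: "('v, 'k) mpoly"
    assume "x \<in> carrier (poly_ring V)"
    then show "\<exists>y\<in>carrier (poly_ring V). y \<oplus>\<^bsub>poly_ring V\<^esub> x = \<zero>\<^bsub>poly_ring V\<^esub>"
      by (intro bexI[of _ "- x"]) (simp_all add: poly_ring_uminus_closed)
  qed (simp_all add: poly_ring_add_closed add.assoc add.commute, simp add: mem_poly_ring)
  show "Group.comm_monoid (poly_ring V :: ('v, 'k) mpoly ring)"
    by (rule comm_monoidI) (simp_all add: poly_ring_mult_closed mult.assoc mult.commute)
qed (simp add: distrib_right)

lemma poly_ring_a_inv:
  fixes p :: "('v, 'k::field) mpoly"
  assumes "p \<in> carrier (poly_ring V)"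
  shows "\<ominus>\<^bsub>poly_ring V\<^esub> p = - p"
proof -
  interpret cring "poly_ring V :: ('v, 'k) mpoly ring"
    by (rule poly_ring_cring)
  show ?thesis
    using assms poly_ring_uminus_closed[OF assms] by (intro minus_equality) simp_all
qed

lemma poly_mapping_sum_single:
  "p = (\<Sum>a\<in>Poly_Mapping.keys p. Poly_Mapping.single a (Poly_Mapping.lookup p a))"
proof (rule poly_mapping_eqI)
  fix k
  have "(\<Sum>a\<in>Poly_Mapping.keys p.
      Poly_Mapping.lookup (Poly_Mapping.single a (Poly_Mapping.lookup p a)) k)
    = (\<Sum>a\<in>Poly_Mapping.keys p. if k = a then Poly_Mapping.lookup p a else 0)"
    by (intro sum.cong refl) (auto simp: lookup_single when_def)
  also have "\<dots> = Poly_Mapping.lookup p k"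
    by (simp add: in_keys_iff)
  finally show "Poly_Mapping.lookup p k = Poly_Mapping.lookup
      (\<Sum>a\<in>Poly_Mapping.keys p. Poly_Mapping.single a (Poly_Mapping.lookup p a)) k"
    by (simp add: lookup_sum)
qed

lemma ideal_sum_closed:
  fixes I :: "('v, 'k::field) mpoly set"
  assumes "ideal I (poly_ring V)" and "\<And>x. x \<in> A \<Longrightarrow> f x \<in> I"
  shows "sum f A \<in> I"
proof -
  interpret ideal I "poly_ring V" by fact
  show ?thesis
    using assms(2)
  proof (induction A rule: infinite_finite_induct)
    case (insert x A)
    then show ?case using additive_subgroup.a_closed[OF is_additive_subgroup, of "f x" "sum f A"] by simp
  qed (use additive_subgroup.zero_closed[OF is_additive_subgroup] in simp_all)
qed

lemma ideal_mult_closed: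
  fixes I :: "('v, 'k::field) mpoly set"
  assumes "ideal I (poly_ring V)" "p \<in> carrier (poly_ring V)" "q \<in> I"
  shows "p * q \<in> I" "q * p \<in> I"
  using ideal.I_l_closed[OF assms(1,3,2)] by (simp_all add: mult.commute)

lemma ideal_diff_closed:
  fixes I :: "('v, 'k::field) mpoly set"
  assumes I: "ideal I (poly_ring V)" and p: "p \<in> I" and q: "q \<in> I"
  shows "p - q \<in> I"
proof -
  interpret ideal I "poly_ring V" by fact
  have "- q = const_poly (-1) * q"
    by (simp add: const_poly_def single_uminus)
  then have "- q \<in> I"
    using ideal_mult_closed(1)[OF I poly_ring_const q] by metis
  then show ?thesis
    using additive_subgroup.a_closed[OF is_additive_subgroup p, of "- q"] by simp
qed

lemma poly_ring_sum_closed: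
  fixes f :: "'a \<Rightarrow> ('v, 'k::field) mpoly"
  assumes "\<And>x. x \<in> A \<Longrightarrow> f x \<in> carrier (poly_ring V)"
  shows "sum f A \<in> carrier (poly_ring V)"
  using assms by (rule ideal_sum_closed[OF ring.oneideal[OF cring.axioms(1)[OF poly_ring_cring]]])

section \<open>Ideals described by the supports of monomials\<close>

text \<open>The cover ideal has this form, with \<open>C\<close> the predicate of being a vertex cover, and so does
  the ideal generated by a set \<open>S\<close> of variables, with \<open>C\<close> the predicate of meeting
  \<open>S\<close>.\<close>

definition support_ideal :: "'v set \<Rightarrow> ('v set \<Rightarrow> bool) \<Rightarrow> ('v, 'k::field) mpoly set" where
  "support_ideal V C =
     {p \<in> carrier (poly_ring V). \<forall>a\<in>Poly_Mapping.keys p. C (Poly_Mapping.keys a)}"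

lemma support_ideal_ideal:
  assumes C: "\<And>A B. C A \<Longrightarrow> A \<subseteq> B \<Longrightarrow> B \<subseteq> V \<Longrightarrow> C B"
  shows "ideal (support_ideal V C :: ('v, 'k::field) mpoly set) (poly_ring V)"
proof -
  interpret cring "poly_ring V :: ('v, 'k) mpoly ring"
    by (rule poly_ring_cring)
  have mult: "q * p \<in> support_ideal V C"
    if p: "p \<in> support_ideal V C" and q: "q \<in> carrier (poly_ring V)" for p q :: "('v, 'k) mpoly"
  proof -
    have "C (Poly_Mapping.keys k)" if k: "k \<in> Poly_Mapping.keys (q * p)" for k
    proof -
      obtain a b where "a \<in> Poly_Mapping.keys q" "b \<in> Poly_Mapping.keys p" "k = a + b"
        using keys_multE[OF k] by blast
      then show ?thesis
        using p q C[of "Poly_Mapping.keys b" "Poly_Mapping.keys k"]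
        by (auto simp: support_ideal_def mem_poly_ring keys_exponent_add)
    qed
    then show ?thesis
      using p q by (auto simp: support_ideal_def poly_ring_mult_closed)
  qed
  show ?thesis
  proof (rule idealI)
    show "subgroup (support_ideal V C) (add_monoid (poly_ring V :: ('v, 'k) mpoly ring))"
    proof (rule add.subgroupI)
      show "support_ideal V C \<noteq> ({} :: ('v, 'k) mpoly set)"
        by (auto simp: support_ideal_def mem_poly_ring intro!: exI[of _ 0])
    next
      fix p :: "('v, 'k) mpoly" assume "p \<in> support_ideal V C"
      then show "\<ominus>\<^bsub>poly_ring V\<^esub> p \<in> support_ideal V C"
        by (auto simp: support_ideal_def poly_ring_a_inv keys_uminus_eq poly_ring_uminus_closed)
    next
      fix p q :: "('v, 'k) mpoly" assume "p \<in> support_ideal V C" "q \<in> support_ideal V C"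
      then show "p \<oplus>\<^bsub>poly_ring V\<^esub> q \<in> support_ideal V C"
        using keys_add[of p q] by (auto simp: support_ideal_def poly_ring_add_closed)
    qed (auto simp: support_ideal_def)
  qed (use mult in \<open>auto simp: mult.commute ring_axioms\<close>)
qed

text \<open>Integer polynomials are linearly ordered by the sign of the leading coefficient. Sending the
  variables to distinct powers of the indeterminate therefore yields a monomial order, for finitely many
  variables of an arbitrary type.\<close>

lemma additive_weight_exists:
  fixes V :: "'v set"
  assumes "finite V"
  obtains w :: "('v \<Rightarrow>\<^sub>0 nat) \<Rightarrow> int poly"
  where "\<And>a b. w (a + b) = w a + w b" "inj_on w {a. Poly_Mapping.keys a \<subseteq> V}"
proof -
  obtain e :: "'v \<Rightarrow> nat" where e: "inj_on e V"
    using finite_imp_inj_to_nat_seg[OF assms] by blast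
  define w :: "('v \<Rightarrow>\<^sub>0 nat) \<Rightarrow> int poly" where
    "w a = (\<Sum>v\<in>V. Polynomial.monom (int (Poly_Mapping.lookup a v)) (e v))" for a
  have coeff_w: "Polynomial.coeff (w a) (e u) = int (Poly_Mapping.lookup a u)" if "u \<in> V" for a u
  proof -
    have "Polynomial.coeff (w a) (e u) = (\<Sum>v\<in>V. if v = u then int (Poly_Mapping.lookup a v) else 0)"
      unfolding w_def coeff_sum using e that by (intro sum.cong refl) (auto dest: inj_onD)
    then show ?thesis using assms that by simp
  qed
  have "inj_on w {a. Poly_Mapping.keys a \<subseteq> V}"
  proof (intro inj_onI poly_mapping_eqI)
    fix a b u
    assume ab: "a \<in> {a. Poly_Mapping.keys a \<subseteq> V}" "b \<in> {a. Poly_Mapping.keys a \<subseteq> V}" "w a = w b"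
    show "Poly_Mapping.lookup a u = Poly_Mapping.lookup b u"
    proof (cases "u \<in> V")
      case True
      then show ?thesis using coeff_w[of u a] coeff_w[of u b] ab(3) by simp
    next
      case False
      then have "u \<notin> Poly_Mapping.keys a" "u \<notin> Poly_Mapping.keys b" using ab by auto
      then show ?thesis by (simp add: in_keys_iff)
    qed
  qed
  moreover have "w (a + b) = w a + w b" for a b
    by (simp add: w_def lookup_add add_monom[symmetric] sum.distrib)
  ultimately show ?thesis using that by blast
qed

lemma lookup_mult_unique_decomposition:
  fixes a b :: "'a::cancel_comm_monoid_add" and p q :: "'a \<Rightarrow>\<^sub>0 'b::semiring_0"
  assumes "\<And>a' b'. a' \<in> Poly_Mapping.keys p \<Longrightarrow> b' \<in> Poly_Mapping.keys q \<Longrightarrow>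
    a' + b' = a + b \<Longrightarrow> a' = a"
  shows "Poly_Mapping.lookup (p * q) (a + b) = Poly_Mapping.lookup p a * Poly_Mapping.lookup q b"
proof -
  have "Poly_Mapping.lookup p l * (\<Sum>r. Poly_Mapping.lookup q r when a + b = l + r)
      = (Poly_Mapping.lookup p a * Poly_Mapping.lookup q b when l = a)" for l
  proof (cases "l = a")
    case True
    then show ?thesis by simp
  next
    case False
    show ?thesis
    proof (cases "l \<in> Poly_Mapping.keys p")
      case True
      have "(Poly_Mapping.lookup q r when a + b = l + r) = 0" for r
        using assms[OF True, of r] False
        by (cases "r \<in> Poly_Mapping.keys q") (auto simp: when_def not_in_keys_iff_lookup_eq_zero)
      then show ?thesis using False by simp
    qed (use False in \<open>simp add: in_keys_iff\<close>)
  qed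
  then show ?thesis by (simp add: lookup_mult)
qed

text \<open>Given \<open>p\<close> and \<open>q\<close> outside the ideal, take in each the largest monomial without a variable of
  \<open>S\<close>. As a monomial without a variable of \<open>S\<close> has only factors of the same kind, the product
  of the two is hit by no other pair of monomials, and so it occurs in \<open>p * q\<close>.\<close>

lemma support_ideal_meets_prime:
  assumes V: "finite V"
  shows "primeideal (support_ideal V (\<lambda>U. U \<inter> S \<noteq> {}) :: ('v, 'k::field) mpoly set) (poly_ring V)"
proof (rule primeidealI)
  let ?P = "support_ideal V (\<lambda>U. U \<inter> S \<noteq> {}) :: ('v, 'k::field) mpoly set"
  show "ideal ?P (poly_ring V)"
    by (rule support_ideal_ideal) blast
  show "cring (poly_ring V :: ('v, 'k) mpoly ring)"
    by (rule poly_ring_cring)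
  have "1 \<in> carrier (poly_ring V) - ?P"
    by (simp add: support_ideal_def)
  then show "carrier (poly_ring V) \<noteq> ?P"
    by blast
  fix p q :: "('v, 'k) mpoly"
  assume pq: "p \<in> carrier (poly_ring V)" "q \<in> carrier (poly_ring V)" "p \<otimes>\<^bsub>poly_ring V\<^esub> q \<in> ?P"
  show "p \<in> ?P \<or> q \<in> ?P"
  proof (rule ccontr)
    assume contra: "\<not> (p \<in> ?P \<or> q \<in> ?P)"
    obtain w :: "('v \<Rightarrow>\<^sub>0 nat) \<Rightarrow> int poly" where
      w: "\<And>a b. w (a + b) = w a + w b" "inj_on w {a. Poly_Mapping.keys a \<subseteq> V}"
      using additive_weight_exists[OF V] by blast
    define free where "free f = {a \<in> Poly_Mapping.keys f. Poly_Mapping.keys a \<inter> S = {}}"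
      for f :: "('v, 'k) mpoly"
    have top: "\<exists>a\<in>free f. \<forall>a'\<in>free f. w a' \<le> w a"
      if "f \<in> carrier (poly_ring V)" "f \<notin> ?P" for f
    proof -
      have "finite (w ` free f)" "w ` free f \<noteq> {}"
        using that by (auto simp: free_def support_ideal_def)
      then have "Max (w ` free f) \<in> w ` free f" "\<forall>x\<in>w ` free f. x \<le> Max (w ` free f)"
        by simp_all
      then show ?thesis by (metis image_iff imageI)
    qed
    obtain a where a: "a \<in> free p" "\<And>a'. a' \<in> free p \<Longrightarrow> w a' \<le> w a"
      using top[of p] pq contra by blast
    obtain b where b: "b \<in> free q" "\<And>b'. b' \<in> free q \<Longrightarrow> w b' \<le> w b"
      using top[of q] pq contra by blast
    have "Poly_Mapping.lookup (p * q) (a + b) = Poly_Mapping.lookup p a * Poly_Mapping.lookup q b"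
    proof (rule lookup_mult_unique_decomposition)
      fix a' b'
      assume ab': "a' \<in> Poly_Mapping.keys p" "b' \<in> Poly_Mapping.keys q" "a' + b' = a + b"
      have "Poly_Mapping.keys a' \<union> Poly_Mapping.keys b' = Poly_Mapping.keys a \<union> Poly_Mapping.keys b"
        using ab'(3) by (metis keys_exponent_add)
      then have "a' \<in> free p" "b' \<in> free q"
        using ab' a(1) b(1) by (auto simp: free_def)
      then have "w a' \<le> w a" "w b' \<le> w b"
        using a(2) b(2) by simp_all
      moreover have "w a' + w b' = w a + w b"
        using ab'(3) w(1) by metis
      ultimately have "w a' = w a"
        by (metis add_le_imp_le_right add_mono antisym order_refl add_left_mono)
      then show "a' = a"
        using w(2) ab'(1) a(1) pq(1) by (auto simp: free_def mem_poly_ring dest: inj_onD)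
    qed
    also have "\<dots> \<noteq> 0"
      using a(1) b(1) by (simp add: free_def in_keys_iff)
    finally have "a + b \<in> Poly_Mapping.keys (p * q)"
      by (simp add: in_keys_iff)
    then have "Poly_Mapping.keys (a + b) \<inter> S \<noteq> {}"
      using pq(3) by (auto simp: support_ideal_def)
    then show False
      using a(1) b(1) by (auto simp: free_def keys_exponent_add)
  qed
qed

section \<open>Chains of primes in polynomial rings\<close>

text \<open>The boxes replace the total degree in the dimension count: their cardinalities are at most powers
  of \<open>M + 1\<close>, and no binomial coefficients appear.\<close>

definition exponent_box :: "'v set \<Rightarrow> nat \<Rightarrow> ('v \<Rightarrow>\<^sub>0 nat) set" where
  "exponent_box V M = {a. Poly_Mapping.keys a \<subseteq> V \<and> (\<forall>v. Poly_Mapping.lookup a v \<le> M)}"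

lemma exponent_box_bound:
  assumes V: "finite V"
  shows "finite (exponent_box V M) \<and> card (exponent_box V M) \<le> (M + 1) ^ card V"
proof -
  let ?F = "V \<rightarrow>\<^sub>E {..M}"
  have inj: "inj_on (\<lambda>a. restrict (Poly_Mapping.lookup a) V) (exponent_box V M)"
  proof (intro inj_onI poly_mapping_eqI)
    fix a b u
    assume ab: "a \<in> exponent_box V M" "b \<in> exponent_box V M"
      "restrict (Poly_Mapping.lookup a) V = restrict (Poly_Mapping.lookup b) V"
    show "Poly_Mapping.lookup a u = Poly_Mapping.lookup b u"
    proof (cases "u \<in> V")
      case True
      then show ?thesis using fun_cong[OF ab(3), of u] by simp
    next
      case False
      then have "u \<notin> Poly_Mapping.keys a" "u \<notin> Poly_Mapping.keys b"
        using ab by (auto simp: exponent_box_def)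
      then show ?thesis by (simp add: in_keys_iff)
    qed
  qed
  have sub: "(\<lambda>a. restrict (Poly_Mapping.lookup a) V) ` exponent_box V M \<subseteq> ?F"
    by (auto simp: exponent_box_def)
  have F: "finite ?F" "card ?F = (M + 1) ^ card V"
    using V by (auto simp: card_PiE intro!: finite_PiE)
  show ?thesis
    using inj_on_finite[OF inj sub F(1)] card_inj_on_le[OF inj sub F(1)] F(2) by simp
qed

lemma exponent_box_add:
  "a \<in> exponent_box V M \<Longrightarrow> b \<in> exponent_box V N \<Longrightarrow> a + b \<in> exponent_box V (M + N)"
  by (auto simp: exponent_box_def keys_exponent_add lookup_add add_mono)

lemma exponent_box_mono: "M \<le> N \<Longrightarrow> exponent_box V M \<subseteq> exponent_box V N"
  by (auto simp: exponent_box_def intro: le_trans)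

lemma exponent_box_mult:
  assumes "Poly_Mapping.keys p \<subseteq> exponent_box V M" "Poly_Mapping.keys q \<subseteq> exponent_box V N"
  shows "Poly_Mapping.keys (p * q) \<subseteq> exponent_box V (M + N)"
  using assms by (blast elim!: keys_multE intro: exponent_box_add)

lemma exponent_box_power:
  assumes "Poly_Mapping.keys p \<subseteq> exponent_box V M"
  shows "Poly_Mapping.keys (p ^ k) \<subseteq> exponent_box V (k * M)"
proof (induction k)
  case 0
  then show ?case by (simp add: exponent_box_def)
next
  case (Suc k)
  then show ?case using exponent_box_mult[OF assms Suc] by simp
qed

definition power_product :: "'a::comm_monoid_mult list \<Rightarrow> nat list \<Rightarrow> 'a" where
  "power_product fs ks = prod_list (map2 (^) fs ks)"

lemma power_product_Nil [simp]: "power_product [] ks = 1"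
  by (simp add: power_product_def)

lemma power_product_Cons [simp]:
  "power_product (f # fs) (k # ks) = f ^ k * power_product fs ks"
  by (simp add: power_product_def)

lemma exponent_box_power_product:
  assumes "length ks = length fs" "\<And>f. f \<in> set fs \<Longrightarrow> Poly_Mapping.keys f \<subseteq> exponent_box V D"
    and "\<And>k. k \<in> set ks \<Longrightarrow> k \<le> s"
  shows "Poly_Mapping.keys (power_product fs ks) \<subseteq> exponent_box V (length fs * (s * D))"
  using assms
proof (induction ks fs rule: list_induct2)
  case Nil
  then show ?case by (simp add: exponent_box_def)
next
  case (Cons k ks f fs)
  have "Poly_Mapping.keys (f ^ k) \<subseteq> exponent_box V (s * D)"
    using exponent_box_power[of f V D k] exponent_box_mono[of "k * D" "s * D" V] Cons.prems
    by (auto simp: mult_right_mono)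
  then show ?case
    using exponent_box_mult[of "f ^ k" V "s * D"] Cons by simp
qed

text \<open>This makes the Steinitz bound on the size of independent sets available.\<close>

lemma const_poly_vector_space:
  "vector_space (\<lambda>c p. const_poly c * (p :: ('v, 'k::field) mpoly))"
  by unfold_locales
    (simp_all add: const_poly_def distrib_left distrib_right single_add mult_single
      flip: mult.assoc)

lemma card_le_if_independent:
  fixes T :: "('v, 'k::field) mpoly set"
  assumes S: "finite S" and keys: "\<And>p. p \<in> T \<Longrightarrow> Poly_Mapping.keys p \<subseteq> S"
    and indep: "\<And>u p. (\<Sum>p\<in>T. const_poly (u p) * p) = 0 \<Longrightarrow> p \<in> T \<Longrightarrow> u p = 0"
    and T: "finite T"
  shows "card T \<le> card S"
proof -
  interpret vector_space "\<lambda>c p. const_poly c * (p :: ('v, 'k) mpoly)"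
    by (rule const_poly_vector_space)
  have "independent T"
    using indep T by (auto simp: dependent_finite)
  moreover have "T \<subseteq> span ((\<lambda>a. Poly_Mapping.single a 1) ` S)"
  proof
    fix p assume "p \<in> T"
    have "p = (\<Sum>a\<in>Poly_Mapping.keys p.
        const_poly (Poly_Mapping.lookup p a) * Poly_Mapping.single a 1)"
      by (subst poly_mapping_sum_single) (simp add: const_poly_def mult_single)
    also have "\<dots> \<in> span ((\<lambda>a. Poly_Mapping.single a 1) ` S)"
      using keys[OF \<open>p \<in> T\<close>] by (intro span_sum span_scale span_base) auto
    finally show "p \<in> span ((\<lambda>a. Poly_Mapping.single a 1) ` S)" .
  qed
  ultimately have "card T \<le> card ((\<lambda>a. Poly_Mapping.single a (1::'k)) ` S)"
    using S by (blast dest: independent_span_bound[rotated])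
  also have "\<dots> \<le> card S"
    using S by (rule card_image_le)
  finally show ?thesis .
qed

text \<open>The power products of \<open>N\<close> polynomials with exponents up to \<open>s\<close> number \<open>(s+1)^N\<close>, but they
  live in a space whose dimension grows only like \<open>s^|V|\<close>. For \<open>|V| < N\<close> and large \<open>s\<close> they
  are linearly dependent.\<close>

lemma polynomial_relation_exists:
  fixes fs :: "('v, 'k::field) mpoly list"
  assumes V: "finite V" and fs: "set fs \<subseteq> carrier (poly_ring V)" and len: "card V < length fs"
  obtains A c where "finite A" "A \<subseteq> {ks. length ks = length fs}"
    "(\<Sum>ks\<in>A. const_poly (c ks) * power_product fs ks) = 0" "\<exists>ks\<in>A. c ks \<noteq> 0"
proof -
  define N where "N = length fs"
  define D where "D = Max (insert 0 (\<Union>f\<in>set fs. \<Union>a\<in>Poly_Mapping.keys f. Poly_Mapping.lookup a ` V))"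
  have D: "Poly_Mapping.keys f \<subseteq> exponent_box V D" if f: "f \<in> set fs" for f
  proof
    fix a assume a: "a \<in> Poly_Mapping.keys f"
    have aV: "Poly_Mapping.keys a \<subseteq> V"
      using subsetD[OF fs f] a by (auto simp: mem_poly_ring)
    have "Poly_Mapping.lookup a v \<le> D" for v
    proof (cases "v \<in> V")
      case True
      then show ?thesis unfolding D_def using V a f by (intro Max_ge) auto
    next
      case False
      then have "v \<notin> Poly_Mapping.keys a" using aV by blast
      then show ?thesis by (simp add: in_keys_iff)
    qed
    then show "a \<in> exponent_box V D" using aV by (simp add: exponent_box_def)
  qed
  \<comment> \<open>This \<open>s\<close> makes \<open>(N * s * D + 1) ^ card V < (s + 1) ^ (card V + 1)\<close>,
    because \<open>N * s * D + 1 \<le> (N * D + 1) * (s + 1)\<close>.\<close>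
  define s where "s = (N * D + 1) ^ card V"
  define A where "A = {ks. set ks \<subseteq> {..s} \<and> length ks = N}"
  have A: "finite A" "card A = (s + 1) ^ N"
    unfolding A_def by (simp_all add: finite_lists_length_eq card_lists_length_eq)
  define box where "box = exponent_box V (N * (s * D))"
  have keys: "Poly_Mapping.keys (power_product fs ks) \<subseteq> box" if "ks \<in> A" for ks
    unfolding box_def N_def
    using that D by (intro exponent_box_power_product) (auto simp: A_def N_def)
  have box: "finite box" "card box < card A"
  proof -
    show "finite box" unfolding box_def using exponent_box_bound[OF V] by blast
    have "card box \<le> (N * (s * D) + 1) ^ card V"
      unfolding box_def using exponent_box_bound[OF V] by blast
    also have "\<dots> \<le> ((N * D + 1) * (s + 1)) ^ card V"
      by (intro power_mono) (auto simp: algebra_simps)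
    also have "\<dots> = s * (s + 1) ^ card V"
      by (simp only: s_def power_mult_distrib)
    also have "\<dots> < (s + 1) ^ Suc (card V)"
      by simp
    also have "\<dots> \<le> (s + 1) ^ N"
      using len by (intro power_increasing) (auto simp: N_def)
    finally show "card box < card A" using A by simp
  qed
  have A_len: "A \<subseteq> {ks. length ks = length fs}"
    by (auto simp: A_def N_def)
  show thesis
  proof (cases "inj_on (power_product fs) A")
    case True
    have "\<exists>u. (\<Sum>p\<in>power_product fs ` A. const_poly (u p) * p) = 0 \<and> (\<exists>p\<in>power_product fs ` A. u p \<noteq> 0)"
    proof (rule ccontr)
      assume contra: "\<not> ?thesis"
      have "card (power_product fs ` A) \<le> card box"
        by (rule card_le_if_independent[OF box(1)]) (use keys contra A in blast)+
      then show False
        using box(2) card_image[OF True] by simp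
    qed
    then obtain u where u: "(\<Sum>p\<in>power_product fs ` A. const_poly (u p) * p) = 0"
      "\<exists>p\<in>power_product fs ` A. u p \<noteq> 0" by blast
    show thesis
      by (rule that[of A "\<lambda>ks. u (power_product fs ks)"])
        (use u A(1) A_len True in \<open>auto simp: sum.reindex\<close>)
  next
    case False
    then obtain k l where kl: "k \<in> A" "l \<in> A" "k \<noteq> l" "power_product fs k = power_product fs l"
      by (auto simp: inj_on_def)
    show thesis
      by (rule that[of "{k, l}" "\<lambda>j. if j = k then 1 else - 1"])
        (use kl A_len in \<open>auto simp: const_poly_def single_uminus\<close>)
  qed
qed

lemma primeideal_poly_ringD:
  fixes P :: "('v, 'k::field) mpoly set"
  assumes "primeideal P (poly_ring V)"
  shows "ideal P (poly_ring V)" "1 \<notin> P" "P \<subseteq> carrier (poly_ring V)"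
    "\<And>p q. p \<in> carrier (poly_ring V) \<Longrightarrow> q \<in> carrier (poly_ring V) \<Longrightarrow> p * q \<in> P \<Longrightarrow> p \<in> P \<or> q \<in> P"
proof -
  interpret primeideal P "poly_ring V" by fact
  show "ideal P (poly_ring V)" by (rule is_ideal)
  show "1 \<notin> P" using one_imp_carrier I_notcarr by auto
  show "P \<subseteq> carrier (poly_ring V)" using a_subset by simp
  show "p \<in> P \<or> q \<in> P"
    if "p \<in> carrier (poly_ring V)" "q \<in> carrier (poly_ring V)" "p * q \<in> P" for p q
    using I_prime[of p q] that by simp
qed

lemma power_poly_ring: "p \<in> carrier (poly_ring V) \<Longrightarrow> p ^ k \<in> carrier (poly_ring V)"
  by (induction k) (simp_all add: poly_ring_mult_closed)

lemma power_product_poly_ring: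
  assumes "set fs \<subseteq> carrier (poly_ring V)" "length ks = length fs"
  shows "power_product fs ks \<in> carrier (poly_ring V)"
  using assms(2,1) by (induction ks fs rule: list_induct2)
    (simp_all add: poly_ring_mult_closed power_poly_ring)

lemma prime_power_not_mem:
  fixes P :: "('v, 'k::field) mpoly set"
  assumes "primeideal P (poly_ring V)" "f \<in> carrier (poly_ring V)" "f \<notin> P"
  shows "f ^ k \<notin> P"
proof (induction k)
  case 0
  then show ?case using primeideal_poly_ringD(2)[OF assms(1)] by simp
next
  case (Suc k)
  then show ?case
    using primeideal_poly_ringD(4)[OF assms(1,2) power_poly_ring[OF assms(2)], of k] assms(3)
    by auto
qed

text \<open>Elements \<open>f\<^sub>i\<close> of the successive differences of a chain of primes are algebraically independent,
  even modulo the first prime. In a relation modulo \<open>P 0\<close>, the highest common power of the first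
  element may be cancelled, since \<open>P 0\<close> is prime. Modulo \<open>P 1\<close>, which contains that element, only
  the terms free of it remain: a shorter relation for the rest of the chain.\<close>

lemma prime_chain_independent:
  fixes P :: "nat \<Rightarrow> ('v, 'k::field) mpoly set"
  assumes "\<And>i. i \<le> length fs \<Longrightarrow> primeideal (P i) (poly_ring V)"
    and "\<And>i. i < length fs \<Longrightarrow> P i \<subseteq> P (Suc i)"
    and "\<And>i. i < length fs \<Longrightarrow> fs ! i \<in> P (Suc i) - P i"
    and "finite A" "A \<subseteq> {ks. length ks = length fs}"
    and "(\<Sum>ks\<in>A. const_poly (c ks) * power_product fs ks) \<in> P 0"
  shows "\<forall>ks\<in>A. c ks = 0"
  using assms
proof (induction fs arbitrary: P A c)
  case Nil
  show ?case
  proof (rule ccontr)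
    assume "\<not> ?thesis"
    moreover have "A \<subseteq> {[]}" using Nil.prems(5) by auto
    ultimately have A: "A = {[]}" and c: "c [] \<noteq> 0" by auto
    note P0 = primeideal_poly_ringD[OF Nil.prems(1)[of 0, simplified]]
    have "const_poly (c []) \<in> P 0" using Nil.prems(6) A by simp
    then have "const_poly (inverse (c [])) * const_poly (c []) \<in> P 0"
      using ideal_mult_closed(1)[OF P0(1)] by simp
    also have "const_poly (inverse (c [])) * const_poly (c []) = (1 :: ('v, 'k) mpoly)"
      using c by (simp add: const_poly_def mult_single)
    finally show False using P0(2) by simp
  qed
next
  case (Cons f fs)
  have P: "primeideal (P 0) (poly_ring V)" "primeideal (P 1) (poly_ring V)"
    using Cons.prems(1)[of 0] Cons.prems(1)[of 1] by simp_all
  note P0 = primeideal_poly_ringD[OF P(1)] and P1 = primeideal_poly_ringD[OF P(2)]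
  have P01: "P 0 \<subseteq> P 1" using Cons.prems(2)[of 0] by simp
  have f: "f \<in> P 1" "f \<notin> P 0" "f \<in> carrier (poly_ring V)"
    using Cons.prems(3)[of 0] P1(3) by auto
  have fs: "set fs \<subseteq> carrier (poly_ring V)"
  proof
    fix g assume "g \<in> set fs"
    then obtain i where i: "i < length fs" "g = fs ! i" by (auto simp: in_set_conv_nth)
    then show "g \<in> carrier (poly_ring V)"
      using Cons.prems(3)[of "Suc i"] primeideal_poly_ringD(3)[OF Cons.prems(1)[of "Suc (Suc i)"]]
      by auto
  qed
  show ?case
  proof (rule ccontr)
    assume contra: "\<not> ?thesis"
    define A' where "A' = {ks \<in> A. c ks \<noteq> 0}"
    have A': "finite A'" "A' \<noteq> {}" using Cons.prems(4) contra by (auto simp: A'_def)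
    \<comment> \<open>The exponent of the highest power of \<open>f\<close> common to all terms.\<close>
    define j where "j = Min (hd ` A')"
    have j: "j \<in> hd ` A'" "\<And>ks. ks \<in> A' \<Longrightarrow> j \<le> hd ks"
      using A' by (auto simp: j_def)
    have len: "length (tl ks) = length fs" "ks = hd ks # tl ks" if "ks \<in> A'" for ks
    proof -
      have "length ks = Suc (length fs)" using that Cons.prems(5) by (auto simp: A'_def)
      then show "length (tl ks) = length fs" "ks = hd ks # tl ks" by (cases ks; simp)+
    qed
    have split: "power_product (f # fs) ks = f ^ hd ks * power_product fs (tl ks)" if "ks \<in> A'" for ks
      using len[OF that] power_product_Cons by metis
    define tm where "tm ks = const_poly (c ks) * power_product fs (tl ks)" for ks
    have tm: "tm ks \<in> carrier (poly_ring V)" if "ks \<in> A'" for ks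
      unfolding tm_def
      by (intro poly_ring_mult_closed power_product_poly_ring fs) (simp_all add: len(1)[OF that] del: length_tl)
    define G where "G = (\<Sum>ks\<in>A'. f ^ (hd ks - j) * tm ks)"
    have "(\<Sum>ks\<in>A. const_poly (c ks) * power_product (f # fs) ks)
        = (\<Sum>ks\<in>A'. const_poly (c ks) * power_product (f # fs) ks)"
      unfolding A'_def using Cons.prems(4)
      by (intro sum.mono_neutral_right) (auto simp: const_poly_def)
    also have "\<dots> = (\<Sum>ks\<in>A'. f ^ j * (f ^ (hd ks - j) * tm ks))"
    proof (rule sum.cong[OF refl])
      fix ks assume ks: "ks \<in> A'"
      have "f ^ hd ks = f ^ j * f ^ (hd ks - j)"
        using j(2)[OF ks] by (simp flip: power_add)
      then show "const_poly (c ks) * power_product (f # fs) ks = f ^ j * (f ^ (hd ks - j) * tm ks)"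
        unfolding split[OF ks] tm_def by (simp add: mult_ac)
    qed
    also have "\<dots> = f ^ j * G"
      by (simp add: G_def sum_distrib_left)
    finally have "f ^ j * G \<in> P 0"
      using Cons.prems(6) by simp
    moreover have "G \<in> carrier (poly_ring V)"
      unfolding G_def by (intro poly_ring_sum_closed poly_ring_mult_closed power_poly_ring f tm)
    ultimately have "G \<in> P 0"
      using P0(4)[of "f ^ j" G] prime_power_not_mem[OF P(1) f(3,2)] power_poly_ring[OF f(3)] by blast
    then have G: "G \<in> P 1" using P01 by blast
    \<comment> \<open>The terms free of \<open>f\<close> after the cancellation; all others vanish modulo \<open>P 1\<close>.\<close>
    define A0 where "A0 = {ks \<in> A'. hd ks = j}"
    have "G = (\<Sum>ks\<in>A0. f ^ (hd ks - j) * tm ks) + (\<Sum>ks\<in>A' - A0. f ^ (hd ks - j) * tm ks)"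
      unfolding G_def using A'(1) by (subst add.commute, intro sum.subset_diff) (auto simp: A0_def)
    also have "(\<Sum>ks\<in>A0. f ^ (hd ks - j) * tm ks) = (\<Sum>ks\<in>A0. tm ks)"
      by (intro sum.cong refl) (simp add: A0_def)
    finally have "(\<Sum>ks\<in>A0. tm ks) = G - (\<Sum>ks\<in>A' - A0. f ^ (hd ks - j) * tm ks)"
      by simp
    moreover have "(\<Sum>ks\<in>A' - A0. f ^ (hd ks - j) * tm ks) \<in> P 1"
    proof (rule ideal_sum_closed[OF P1(1)])
      fix ks assume ks: "ks \<in> A' - A0"
      then have "j < hd ks"
        using j(2)[of ks] by (auto simp: A0_def)
      then obtain d where d: "hd ks - j = Suc d"
        using Suc_diff_Suc by metis
      have "(f ^ d * tm ks) * f \<in> P 1"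
        by (intro ideal_mult_closed(1)[OF P1(1) _ f(1)] poly_ring_mult_closed power_poly_ring f tm)
          (use ks in simp)
      then show "f ^ (hd ks - j) * tm ks \<in> P 1"
        by (simp add: d mult_ac)
    qed
    ultimately have A0_P1: "(\<Sum>ks\<in>A0. tm ks) \<in> P 1"
      using ideal_diff_closed[OF P1(1) G] by simp
    have A0_Cons: "ks = j # tl ks" if "ks \<in> A0" for ks
    proof -
      have "ks \<in> A'" "hd ks = j" using that by (simp_all add: A0_def)
      then show ?thesis using len(2)[of ks] by simp
    qed
    have inj: "inj_on tl A0"
    proof (rule inj_onI)
      fix ks ls assume "ks \<in> A0" "ls \<in> A0" "tl ks = tl ls"
      then show "ks = ls" using A0_Cons[of ks] A0_Cons[of ls] by simp
    qed
    have "(\<Sum>ks\<in>tl ` A0. const_poly (c (j # ks)) * power_product fs ks) = (\<Sum>ks\<in>A0. tm ks)"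
      unfolding sum.reindex[OF inj] o_def tm_def
      by (intro sum.cong refl) (simp flip: A0_Cons)
    then have "(\<Sum>ks\<in>tl ` A0. const_poly (c (j # ks)) * power_product fs ks) \<in> P 1"
      using A0_P1 by simp
    moreover have "fs ! i \<in> P (Suc (Suc i)) - P (Suc i)" if "i < length fs" for i
      using Cons.prems(3)[of "Suc i"] that by simp
    moreover have "tl ` A0 \<subseteq> {ks. length ks = length fs}"
      using len(1) by (auto simp: A0_def simp del: length_tl)
    ultimately have "\<forall>ks\<in>tl ` A0. c (j # ks) = 0"
      using Cons.prems(1,2) A'(1)
      by (intro Cons.IH[of "\<lambda>i. P (Suc i)"]) (simp_all add: A0_def)
    moreover obtain ks where ks: "ks \<in> A0" using j(1) by (auto simp: A0_def)
    ultimately have "c ks = 0" using A0_Cons[OF ks] by (metis imageI)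
    then show False using ks by (simp add: A0_def A'_def)
  qed
qed

text \<open>The witnesses of strictness use only variables in \<open>U\<close>, whereas the primes may live in a
  larger ring. Such witnesses exist if the primes contain the variables outside \<open>U\<close>.\<close>

lemma prime_chain_length_le:
  fixes P :: "nat \<Rightarrow> ('v, 'k::field) mpoly set"
  assumes "finite U"
    and "\<And>i. i \<le> n \<Longrightarrow> primeideal (P i) (poly_ring V)"
    and "\<And>i. i < n \<Longrightarrow> P i \<subseteq> P (Suc i)"
    and "\<And>i. i < n \<Longrightarrow> (P (Suc i) - P i) \<inter> carrier (poly_ring U) \<noteq> {}"
  shows "n \<le> card U"
proof (rule ccontr)
  assume contra: "\<not> n \<le> card U"
  have "\<forall>i. \<exists>f. i < n \<longrightarrow> f \<in> (P (Suc i) - P i) \<inter> carrier (poly_ring U)"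
    using assms(4) by blast
  then obtain f where f: "\<And>i. i < n \<Longrightarrow> f i \<in> (P (Suc i) - P i) \<inter> carrier (poly_ring U)"
    by metis
  define fs where "fs = map f [0..<n]"
  have fs: "length fs = n" "set fs \<subseteq> carrier (poly_ring U)"
    "\<And>i. i < n \<Longrightarrow> fs ! i \<in> P (Suc i) - P i"
    using f by (auto simp: fs_def)
  have len: "card U < length fs"
    using contra fs(1) by simp
  obtain A c where Ac: "finite A" "A \<subseteq> {ks. length ks = length fs}"
    "(\<Sum>ks\<in>A. const_poly (c ks) * power_product fs ks) = 0" "\<exists>ks\<in>A. c ks \<noteq> 0"
    by (rule polynomial_relation_exists[OF assms(1) fs(2) len])
  have "0 \<in> P 0"
    using additive_subgroup.zero_closed[OF ideal.axioms(1)[OF primeideal_poly_ringD(1)[OF assms(2)[of 0]]]]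
    by simp
  then have "\<forall>ks\<in>A. c ks = 0"
    using assms(2,3) fs(1,3) Ac(1-3)
    by (intro prime_chain_independent[of fs P V A c]) simp_all
  then show False
    using Ac(4) by blast
qed

section \<open>Generation by squarefree monomials\<close>

lemma support_split:
  fixes p :: "('v, 'k::field) mpoly"
  assumes "p \<in> carrier (poly_ring V)"
  obtains p0 p1 where "p = p0 + p1" "p1 \<in> support_ideal V C"
    "Poly_Mapping.keys p0 \<subseteq> {a \<in> Poly_Mapping.keys p. \<not> C (Poly_Mapping.keys a)}"
proof -
  define part where "part P = (\<Sum>a\<in>{a \<in> Poly_Mapping.keys p. P a}.
    Poly_Mapping.single a (Poly_Mapping.lookup p a))" for P :: "('v \<Rightarrow>\<^sub>0 nat) \<Rightarrow> bool"
  have keys: "Poly_Mapping.keys (part P) \<subseteq> {a \<in> Poly_Mapping.keys p. P a}" for P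
  proof
    fix k assume "k \<in> Poly_Mapping.keys (part P)"
    then have "Poly_Mapping.lookup (part P) k \<noteq> 0" by (simp add: in_keys_iff)
    then obtain a where "a \<in> Poly_Mapping.keys p" "P a"
      "Poly_Mapping.lookup (Poly_Mapping.single a (Poly_Mapping.lookup p a)) k \<noteq> 0"
      unfolding part_def lookup_sum by (auto dest: sum.not_neutral_contains_not_neutral)
    then show "k \<in> {a \<in> Poly_Mapping.keys p. P a}" by (auto simp: lookup_single when_def split: if_splits)
  qed
  have "p = part (\<lambda>a. \<not> C (Poly_Mapping.keys a)) + part (\<lambda>a. C (Poly_Mapping.keys a))"
    unfolding part_def by (subst poly_mapping_sum_single, subst sum.union_disjoint[symmetric])
      (auto intro!: sum.cong)
  moreover have "part (\<lambda>a. C (Poly_Mapping.keys a)) \<in> support_ideal V C"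
    using keys[of "\<lambda>a. C (Poly_Mapping.keys a)"] assms by (auto simp: support_ideal_def mem_poly_ring)
  ultimately show thesis using that keys by blast
qed

lemma single_dvd:
  fixes a b :: "'v \<Rightarrow>\<^sub>0 nat" and c :: "'k::field"
  assumes "\<And>v. Poly_Mapping.lookup b v \<le> Poly_Mapping.lookup a v"
  shows "Poly_Mapping.single a c = Poly_Mapping.single (a - b) c * Poly_Mapping.single b 1"
proof -
  have "a = (a - b) + b"
    using assms by (intro poly_mapping_eqI) (simp add: lookup_add lookup_minus)
  then show ?thesis by (metis mult_single mult.right_neutral)
qed

lemma keys_exponent_diff:
  fixes a b :: "'v \<Rightarrow>\<^sub>0 nat"
  shows "Poly_Mapping.keys (a - b) \<subseteq> Poly_Mapping.keys a"
  by (auto simp: in_keys_iff lookup_minus)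

text \<open>A support ideal is generated by squarefree monomials. Hence containment can be tested on
  products of distinct variables.\<close>

lemma support_ideal_subset:
  fixes Q :: "('v, 'k::field) mpoly set"
  assumes Q: "ideal Q (poly_ring V)"
    and gen: "\<And>A. A \<subseteq> V \<Longrightarrow> finite A \<Longrightarrow> C A \<Longrightarrow> \<exists>W\<subseteq>A. (\<Prod>v\<in>W. var_poly v) \<in> Q"
  shows "support_ideal V C \<subseteq> Q"
proof
  fix p :: "('v, 'k) mpoly" assume p: "p \<in> support_ideal V C"
  show "p \<in> Q"
  proof (subst poly_mapping_sum_single, rule ideal_sum_closed[OF Q])
    fix a assume a: "a \<in> Poly_Mapping.keys p"
    have aV: "Poly_Mapping.keys a \<subseteq> V" and C: "C (Poly_Mapping.keys a)"
      using p a by (auto simp: support_ideal_def mem_poly_ring)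
    obtain W where W: "W \<subseteq> Poly_Mapping.keys a" "(\<Prod>v\<in>W. var_poly v) \<in> Q"
      using gen[OF aV _ C] by auto
    have "finite W" using finite_subset[OF W(1)] by simp
    then have prod: "(\<Prod>v\<in>W. var_poly v) = Poly_Mapping.single (\<Sum>v\<in>W. Poly_Mapping.single v 1) (1 :: 'k)"
      by (induction W) (simp_all add: var_poly_def mult_single)
    have "Poly_Mapping.lookup (\<Sum>v\<in>W. Poly_Mapping.single v 1) u \<le> Poly_Mapping.lookup a u" for u
    proof -
      have "Poly_Mapping.lookup (\<Sum>v\<in>W. Poly_Mapping.single v (1::nat)) u = (if u \<in> W then 1 else 0)"
        using \<open>finite W\<close> by (auto simp: lookup_sum lookup_single when_def)
      then show ?thesis
        using W(1) by (auto simp: in_keys_iff subset_iff Suc_le_eq)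
    qed
    from single_dvd[of "\<Sum>v\<in>W. Poly_Mapping.single v 1" a "Poly_Mapping.lookup p a", OF this]
    have "Poly_Mapping.single a (Poly_Mapping.lookup p a)
      = Poly_Mapping.single (a - (\<Sum>v\<in>W. Poly_Mapping.single v 1)) (Poly_Mapping.lookup p a) * (\<Prod>v\<in>W. var_poly v)"
      unfolding prod .
    also have "\<dots> \<in> Q"
      using aV keys_exponent_diff[of a "\<Sum>v\<in>W. Poly_Mapping.single v 1"]
      by (intro ideal_mult_closed(1)[OF Q _ W(2)] poly_ring_single) simp
    finally show "Poly_Mapping.single a (Poly_Mapping.lookup p a) \<in> Q" .
  qed
qed

lemma keys_prod_var_poly:
  assumes "finite W"
  obtains a where "(\<Prod>v\<in>W. var_poly v) = (Poly_Mapping.single a 1 :: ('v, 'k::field) mpoly)"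
    "Poly_Mapping.keys a = W"
  using assms
proof (induction W arbitrary: thesis)
  case empty
  then show ?case by (metis single_one keys_zero prod.empty)
next
  case (insert v W)
  obtain a where a: "(\<Prod>v\<in>W. var_poly v) = (Poly_Mapping.single a 1 :: ('v, 'k::field) mpoly)"
    "Poly_Mapping.keys a = W" by (rule insert.IH)
  show ?case
    by (rule insert.prems[of "Poly_Mapping.single v 1 + a"])
      (use a insert.hyps in \<open>simp_all add: var_poly_def mult_single keys_exponent_add\<close>)
qed

lemma prod_var_poly_support_ideal:
  assumes "finite W" "W \<subseteq> V" "C W"
  shows "(\<Prod>v\<in>W. var_poly v) \<in> (support_ideal V C :: ('v, 'k::field) mpoly set)"
proof -
  obtain a where "(\<Prod>v\<in>W. var_poly v) = (Poly_Mapping.single a 1 :: ('v, 'k::field) mpoly)"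
    "Poly_Mapping.keys a = W" using keys_prod_var_poly[OF assms(1)] by blast
  then show ?thesis using assms by (simp add: support_ideal_def mem_poly_ring)
qed

lemma var_poly_mem_meets:
  "(var_poly v :: ('v, 'k::field) mpoly) \<in> support_ideal V (\<lambda>U. U \<inter> S \<noteq> {}) \<longleftrightarrow> v \<in> V \<and> v \<in> S"
  by (auto simp: support_ideal_def mem_poly_ring var_poly_def)

section \<open>The cover ideal\<close>

lemma vertex_cover_mono: "vertex_cover V E A \<Longrightarrow> A \<subseteq> B \<Longrightarrow> B \<subseteq> V \<Longrightarrow> vertex_cover V E B"
  unfolding vertex_cover_def by blast

lemma minimal_vertex_cover_exists:
  assumes "vertex_cover V E A" "finite A"
  obtains W where "W \<subseteq> A" "minimal_vertex_cover V E W"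
proof -
  have "finite {W \<in> Pow A. vertex_cover V E W}" "A \<in> {W \<in> Pow A. vertex_cover V E W}"
    using assms by auto
  then obtain W where W: "W \<in> {W \<in> Pow A. vertex_cover V E W}" "W \<subseteq> A"
    "\<forall>W'\<in>{W \<in> Pow A. vertex_cover V E W}. W' \<subseteq> W \<longrightarrow> W = W'"
    using finite_has_minimal2 by meson
  then show thesis
    by (intro that[of W]) (auto simp: minimal_vertex_cover_def)
qed

lemma vertex_cover_ideal:
  "ideal (support_ideal V (vertex_cover V E) :: ('v, 'k::field) mpoly set) (poly_ring V)"
  by (rule support_ideal_ideal) (rule vertex_cover_mono)

lemma cover_ideal_eq_support_ideal:
  assumes "finite V"
  shows "cover_ideal V E = (support_ideal V (vertex_cover V E) :: ('v, 'k::field) mpoly set)"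
proof
  interpret cring "poly_ring V :: ('v, 'k) mpoly ring" by (rule poly_ring_cring)
  let ?G = "{\<Prod>v\<in>W. var_poly v | W. minimal_vertex_cover V E W} :: ('v, 'k) mpoly set"
  have fin: "finite W" "W \<subseteq> V" "vertex_cover V E W" if "minimal_vertex_cover V E W" for W
    using that finite_subset[OF _ assms, of W] by (auto simp: minimal_vertex_cover_def vertex_cover_def)
  have G: "?G \<subseteq> support_ideal V (vertex_cover V E)"
    by (auto intro!: prod_var_poly_support_ideal fin)
  then show "cover_ideal V E \<subseteq> (support_ideal V (vertex_cover V E) :: ('v, 'k) mpoly set)"
    unfolding cover_ideal_def by (intro genideal_minimal vertex_cover_ideal)
  have "?G \<subseteq> carrier (poly_ring V)"
    using G by (auto simp: support_ideal_def)
  note gen = genideal_ideal[OF this] genideal_self[OF this]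
  show "support_ideal V (vertex_cover V E) \<subseteq> (cover_ideal V E :: ('v, 'k) mpoly set)"
    unfolding cover_ideal_def
  proof (rule support_ideal_subset[OF gen(1)])
    fix A assume A: "finite A" "vertex_cover V E A"
    obtain W where W: "W \<subseteq> A" "minimal_vertex_cover V E W"
      by (rule minimal_vertex_cover_exists[OF A(2,1)])
    have "(\<Prod>v\<in>W. var_poly v) \<in> ?G" using W(2) by auto
    then have "(\<Prod>v\<in>W. var_poly v) \<in> Idl\<^bsub>poly_ring V\<^esub> ?G"
      by (rule subsetD[OF gen(2)])
    then show "\<exists>W\<subseteq>A. (\<Prod>v\<in>W. var_poly v) \<in> Idl\<^bsub>poly_ring V\<^esub> ?G"
      using W(1) by blast
  qed
qed

section \<open>Krull dimension of the quotient\<close>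

lemma coset_eq_iff:
  fixes I :: "('v, 'k::field) mpoly set"
  assumes I: "ideal I (poly_ring V)" and p: "p \<in> carrier (poly_ring V)" and q: "q \<in> carrier (poly_ring V)"
  shows "I +>\<^bsub>poly_ring V\<^esub> p = I +>\<^bsub>poly_ring V\<^esub> q \<longleftrightarrow> p - q \<in> I"
proof -
  interpret cring "poly_ring V :: ('v, 'k) mpoly ring" by (rule poly_ring_cring)
  show ?thesis
    using quotient_eq_iff_same_a_r_cos[OF assms] q by (simp add: a_minus_def poly_ring_a_inv)
qed

lemma carrier_quotient: "carrier (R Quot I) = (\<lambda>p. I +>\<^bsub>R\<^esub> p) ` carrier R"
  by (auto simp: FactRing_def A_RCOSETS_def' )

lemma prime_prod_mem:
  fixes P :: "('v, 'k::field) mpoly set"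
  assumes P: "primeideal P (poly_ring V)" and "finite W" "W \<subseteq> V" "(\<Prod>v\<in>W. var_poly v) \<in> P"
  shows "\<exists>v\<in>W. var_poly v \<in> P"
  using assms(2-4)
proof (induction W)
  case empty
  then show ?case using primeideal_poly_ringD(2)[OF P] by simp
next
  case (insert v W)
  obtain a where "(\<Prod>v\<in>W. var_poly v) = (Poly_Mapping.single a 1 :: ('v, 'k::field) mpoly)"
    "Poly_Mapping.keys a = W" using keys_prod_var_poly[OF insert.hyps(1)] by blast
  then have "(\<Prod>v\<in>W. var_poly v :: ('v, 'k) mpoly) \<in> carrier (poly_ring V)"
    using insert.prems by (simp add: mem_poly_ring)
  moreover have "(var_poly v :: ('v, 'k) mpoly) \<in> carrier (poly_ring V)"
    using insert.prems by (simp add: mem_poly_ring var_poly_def)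
  ultimately show ?case
    using primeideal_poly_ringD(4)[OF P, of "var_poly v" "\<Prod>v\<in>W. var_poly v"] insert by auto
qed

text \<open>The second part lets strict inclusions between primes pass to the quotient.\<close>

lemma primeideal_image_quotient:
  fixes I P :: "('v, 'k::field) mpoly set"
  assumes I: "ideal I (poly_ring V)" and P: "primeideal P (poly_ring V)" and IP: "I \<subseteq> P"
  shows "primeideal ((\<lambda>p. I +>\<^bsub>poly_ring V\<^esub> p) ` P) (poly_ring V Quot I)"
    and "\<And>p. p \<in> carrier (poly_ring V) \<Longrightarrow>
      I +>\<^bsub>poly_ring V\<^esub> p \<in> (\<lambda>p. I +>\<^bsub>poly_ring V\<^esub> p) ` P \<longleftrightarrow> p \<in> P"
proof -
  interpret cring "poly_ring V :: ('v, 'k) mpoly ring" by (rule poly_ring_cring)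
  let ?h = "\<lambda>p. I +>\<^bsub>poly_ring V\<^esub> p"
  note PD = primeideal_poly_ringD[OF P]
  show mem: "?h p \<in> ?h ` P \<longleftrightarrow> p \<in> P" if p: "p \<in> carrier (poly_ring V)" for p
  proof
    assume "?h p \<in> ?h ` P"
    then obtain q where q: "q \<in> P" "?h p = ?h q" by blast
    then have "p - q \<in> P" using coset_eq_iff[OF I p, of q] PD(3) IP by blast
    then have "(p - q) + q \<in> P"
      using additive_subgroup.a_closed[OF ideal.axioms(1)[OF PD(1)], of "p - q" q] q(1) by simp
    then show "p \<in> P" by simp
  qed blast
  show "primeideal (?h ` P) (poly_ring V Quot I)"
  proof (rule primeidealI)
    show "ideal (?h ` P) (poly_ring V Quot I)"
      by (rule ring_ideal_imp_quot_ideal[OF I PD(1)])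
    show "cring (poly_ring V Quot I)"
      by (rule ideal.quotient_is_cring[OF I poly_ring_cring])
    show "carrier (poly_ring V Quot I) \<noteq> ?h ` P"
      unfolding carrier_quotient using mem[of 1] PD(2) by (metis imageI poly_ring_one)
    fix a b assume "a \<in> carrier (poly_ring V Quot I)" "b \<in> carrier (poly_ring V Quot I)"
      and ab: "a \<otimes>\<^bsub>poly_ring V Quot I\<^esub> b \<in> ?h ` P"
    then obtain x y where xy: "x \<in> carrier (poly_ring V)" "y \<in> carrier (poly_ring V)" "a = ?h x" "b = ?h y"
      by (auto simp: carrier_quotient)
    have "a \<otimes>\<^bsub>poly_ring V Quot I\<^esub> b = ?h (x * y)"
      using ideal.rcoset_mult_add[OF I xy(1,2)] xy(3,4) by (simp add: FactRing_def)
    then have "x * y \<in> P" using ab mem[of "x * y"] xy by (simp add: poly_ring_mult_closed)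
    then show "a \<in> ?h ` P \<or> b \<in> ?h ` P" using PD(4)[OF xy(1,2)] xy(3,4) by blast
  qed
qed

text \<open>Upper bound: if a prime contains the ideal, then the vertices whose variables it does not contain
  do not cover some edge \<open>{u, v}\<close>. For the first prime of a chain, this shows that all its primes
  contain the variables \<open>u\<close> and \<open>v\<close>, and they are told apart by polynomials in the other variables. Lower bound: for an
  edge \<open>{u, v}\<close>, adjoin the remaining variables one at a time to the prime generated by \<open>u\<close> and
  \<open>v\<close>.\<close>

lemma krull_dim_cover_quotient:
  assumes G: "simple_graph V E" and E: "E \<noteq> {}"
  shows "krull_dim (poly_ring V Quot (support_ideal V (vertex_cover V E) :: ('v, 'k::field) mpoly set))
    = enat (card V - 2)"
proof -
  let ?R = "poly_ring V :: ('v, 'k) mpoly ring"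
  let ?I = "support_ideal V (vertex_cover V E) :: ('v, 'k::field) mpoly set"
  let ?h = "\<lambda>p. ?I +>\<^bsub>?R\<^esub> p"
  let ?chain = "\<lambda>n. \<exists>P. (\<forall>i\<le>n. primeideal (P i) (?R Quot ?I)) \<and> (\<forall>i<n. P i \<subset> P (Suc i))"
  have V: "finite V" using G by (simp add: simple_graph_def)
  interpret cring ?R by (rule poly_ring_cring)
  note I = vertex_cover_ideal[of V E, where ?'k = 'k]
  interpret h: ring_hom_ring ?R "?R Quot ?I" ?h
    by (rule ideal.rcos_ring_hom_ring[OF I])
  have upper: "n \<le> card V - 2" if chain: "?chain n" for n
  proof -
    obtain P where P: "\<And>i. i \<le> n \<Longrightarrow> primeideal (P i) (?R Quot ?I)" "\<And>i. i < n \<Longrightarrow> P i \<subset> P (Suc i)"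
      using chain by blast
    define Q where "Q i = {r \<in> carrier ?R. ?h r \<in> P i}" for i
    have Q: "primeideal (Q i) ?R" if "i \<le> n" for i
      unfolding Q_def
      by (rule ring_hom_ring.primeideal_vimage[OF ideal.rcos_ring_hom_ring[OF I] poly_ring_cring P(1)[OF that]])
    have Q_mono: "Q i \<subseteq> Q (Suc i)" if "i < n" for i
      using P(2)[OF that] by (auto simp: Q_def)
    have Q0: "Q 0 \<subseteq> Q i" if "i \<le> n" for i
      using that
    proof (induction i)
      case (Suc i)
      then show ?case using Q_mono[of i] by simp
    qed simp
    have IQ: "?I \<subseteq> Q 0"
    proof
      fix p assume p: "p \<in> ?I"
      have pc: "p \<in> carrier ?R" using p by (simp add: support_ideal_def)
      have "?h p = ?h 0" using coset_eq_iff[OF I pc, of 0] p by (simp add: mem_poly_ring)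
      also have "\<dots> = \<zero>\<^bsub>?R Quot ?I\<^esub>"
        using h.hom_zero by simp
      also have "\<dots> \<in> P 0"
        using additive_subgroup.zero_closed[OF ideal.axioms(1)] primeideal.axioms(1)[OF P(1)[of 0]] by blast
      finally show "p \<in> Q 0" using pc by (simp add: Q_def)
    qed
    \<comment> \<open>\<open>W\<close> is not a cover: otherwise the product of its variables would lie in
      \<open>Q 0\<close>, and so would one of them.\<close>
    define W where "W = {v \<in> V. var_poly v \<notin> Q 0}"
    have "\<not> vertex_cover V E W"
    proof
      assume "vertex_cover V E W"
      moreover have "finite W" "W \<subseteq> V" using V by (auto simp: W_def)
      ultimately have "(\<Prod>v\<in>W. var_poly v) \<in> Q 0"
        using prod_var_poly_support_ideal[of W V "vertex_cover V E"] IQ by blast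
      then show False
        using prime_prod_mem[OF Q[of 0] \<open>finite W\<close> \<open>W \<subseteq> V\<close>] by (auto simp: W_def)
    qed
    then obtain e where e: "e \<in> E" "W \<inter> e = {}"
      by (auto simp: vertex_cover_def W_def)
    then obtain u v where uv: "u \<in> V" "v \<in> V" "u \<noteq> v" "e = {u, v}"
      using G by (auto simp: simple_graph_def)
    let ?S = "{u, v}"
    have meets: "support_ideal V (\<lambda>U. U \<inter> ?S \<noteq> {}) \<subseteq> Q 0"
    proof (rule support_ideal_subset)
      show "ideal (Q 0) ?R" using primeideal_poly_ringD(1)[OF Q[of 0]] by simp
      fix A :: "'v set" assume "A \<inter> ?S \<noteq> {}"
      then obtain w where "w \<in> A" "w \<in> ?S" by blast
      then have "{w} \<subseteq> A" "(\<Prod>v\<in>{w}. var_poly v) \<in> Q 0"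
        using e uv by (auto simp: W_def)
      then show "\<exists>W\<subseteq>A. (\<Prod>v\<in>W. var_poly v) \<in> Q 0" by blast
    qed
    have "(Q (Suc i) - Q i) \<inter> carrier (poly_ring (V - ?S)) \<noteq> {}" if i: "i < n" for i
    proof -
      obtain y where y: "y \<in> P (Suc i)" "y \<notin> P i" using P(2)[OF i] by blast
      have "P (Suc i) \<subseteq> carrier (?R Quot ?I)"
        using additive_subgroup.a_subset[OF ideal.axioms(1)[OF primeideal.axioms(1)[OF P(1)[of "Suc i"]]]] i
        by simp
      then obtain f where f: "f \<in> carrier ?R" "y = ?h f"
        using y(1) by (auto simp: carrier_quotient)
      then have fQ: "f \<in> Q (Suc i)" "f \<notin> Q i" using y by (auto simp: Q_def)
      \<comment> \<open>Dropping the terms divisible by \<open>u\<close> or \<open>v\<close> changes \<open>f\<close> only by an element of \<open>Q 0\<close>.\<close>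
      obtain f0 f1 where f01: "f = f0 + f1" "f1 \<in> support_ideal V (\<lambda>U. U \<inter> ?S \<noteq> {})"
        "Poly_Mapping.keys f0 \<subseteq> {a \<in> Poly_Mapping.keys f. \<not> (Poly_Mapping.keys a \<inter> ?S \<noteq> {})}"
        by (rule support_split[OF f(1), of "\<lambda>U. U \<inter> ?S \<noteq> {}"])
      have f1: "f1 \<in> Q i" "f1 \<in> Q (Suc i)"
        using meets f01(2) Q0[of i] Q0[of "Suc i"] i by auto
      have "f0 = f - f1" using f01(1) by simp
      then have "f0 \<in> Q (Suc i)"
        using ideal_diff_closed[OF primeideal_poly_ringD(1)[OF Q] fQ(1) f1(2)] i by simp
      moreover have "f0 \<notin> Q i"
        using additive_subgroup.a_closed[OF ideal.axioms(1)[OF primeideal_poly_ringD(1)[OF Q[of i]]], of f0 f1]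
          f1 fQ(2) f01(1) i by auto
      moreover have "f0 \<in> carrier (poly_ring (V - ?S))"
        using f01(3) f(1) by (fastforce simp: mem_poly_ring)
      ultimately show ?thesis by blast
    qed
    then have "n \<le> card (V - ?S)"
      using V Q Q_mono by (intro prime_chain_length_le[of "V - ?S" n Q V]) auto
    then show ?thesis using V uv by (simp add: card_Diff_subset)
  qed
  have lower: "?chain (card V - 2)"
  proof -
    obtain u v where uv: "u \<in> V" "v \<in> V" "u \<noteq> v" "{u, v} \<in> E"
      using G E by (fastforce simp: simple_graph_def)
    obtain vs where vs: "set vs = V - {u, v}" "distinct vs"
      using finite_distinct_list[of "V - {u, v}"] V by blast
    have len: "length vs = card V - 2"
      using distinct_card[OF vs(2)] vs(1) V uv by (simp add: card_Diff_subset)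
    define S where "S i = {u, v} \<union> set (take i vs)" for i
    define P where "P i = (support_ideal V (\<lambda>U. U \<inter> S i \<noteq> {}) :: ('v, 'k) mpoly set)" for i
    have P: "primeideal (P i) ?R" for i
      unfolding P_def by (rule support_ideal_meets_prime[OF V])
    have IP: "?I \<subseteq> P i" for i
    proof -
      have "U \<inter> S i \<noteq> {}" if "vertex_cover V E U" for U
        using that uv(4) by (auto simp: vertex_cover_def S_def)
      then show ?thesis by (auto simp: P_def support_ideal_def)
    qed
    note img = primeideal_image_quotient[OF I P IP]
    have "?h ` P i \<subset> ?h ` P (Suc i)" if i: "i < card V - 2" for i
    proof -
      have "S i \<subseteq> S (Suc i)" 
        using set_take_subset_set_take[of i "Suc i" vs] by (auto simp: S_def)
      then have sub: "P i \<subseteq> P (Suc i)" by (fastforce simp: P_def support_ideal_def)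
      let ?w = "vs ! i"
      have w: "?w \<in> V" "?w \<notin> {u, v}" using vs(1) i len nth_mem[of i vs] by auto
      have "?w \<notin> set (take i vs)"
        using vs(2) i len by (auto simp: in_set_conv_nth nth_eq_iff_index_eq)
      then have "?w \<notin> S i" "?w \<in> S (Suc i)"
        using w i len by (auto simp: S_def take_Suc_conv_app_nth)
      then have "(var_poly ?w :: ('v, 'k) mpoly) \<in> P (Suc i)" "(var_poly ?w :: ('v, 'k) mpoly) \<notin> P i"
        using w by (simp_all add: P_def var_poly_mem_meets)
      moreover have "(var_poly ?w :: ('v, 'k) mpoly) \<in> carrier ?R"
        using w by (simp add: mem_poly_ring var_poly_def)
      ultimately have "?h (var_poly ?w) \<in> ?h ` P (Suc i)" "?h (var_poly ?w) \<notin> ?h ` P i"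
        using img(2) by blast+
      then show ?thesis using sub by blast
    qed
    then show ?thesis
      using img(1) by (intro exI[of _ "\<lambda>i. ?h ` P i"]) blast
  qed
  show ?thesis
    unfolding krull_dim_def
  proof (rule antisym)
    show "Sup {enat n | n. ?chain n} \<le> enat (card V - 2)"
    proof (rule Sup_least)
      fix x assume "x \<in> {enat n | n. ?chain n}"
      then obtain n where "x = enat n" "?chain n" by blast
      then show "x \<le> enat (card V - 2)" using upper[of n] by simp
    qed
    show "enat (card V - 2) \<le> Sup {enat n | n. ?chain n}"
    proof (rule Sup_upper)
      show "enat (card V - 2) \<in> {enat n | n. ?chain n}"
        by (rule CollectI, rule exI, rule conjI[OF refl lower])
    qed
  qed
qed

section \<open>Graded components of the quotient\<close>

lemma monomial_degree_lookup_le: "Poly_Mapping.lookup a v \<le> monomial_degree a"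
proof (cases "v \<in> Poly_Mapping.keys a")
  case True
  then show ?thesis unfolding monomial_degree_def by (intro member_le_sum) auto
qed (simp add: in_keys_iff)

lemma finite_exponents_of_degree:
  assumes "finite V"
  shows "finite {a. Poly_Mapping.keys a \<subseteq> V \<and> monomial_degree a = d}"
proof (rule finite_subset)
  show "{a. Poly_Mapping.keys a \<subseteq> V \<and> monomial_degree a = d} \<subseteq> exponent_box V d"
    by (auto simp: exponent_box_def intro: monomial_degree_lookup_le)
  show "finite (exponent_box V d)"
    using exponent_box_bound[OF assms] by blast
qed

lemma const_poly_subfield:
  "subfield (range const_poly) (poly_ring V :: ('v, 'k::field) mpoly ring)"
proof -
  interpret cring "poly_ring V :: ('v, 'k) mpoly ring" by (rule poly_ring_cring)
  have sr: "subring (range const_poly) (poly_ring V :: ('v, 'k) mpoly ring)"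
  proof (rule subringI)
    show "range const_poly \<subseteq> carrier (poly_ring V :: ('v, 'k) mpoly ring)"
      by auto
    show "\<one>\<^bsub>poly_ring V\<^esub> \<in> range (const_poly :: 'k \<Rightarrow> ('v, 'k) mpoly)"
      by (auto simp: const_poly_def intro!: range_eqI[of _ _ 1])
    fix p q :: "('v, 'k) mpoly" assume "p \<in> range const_poly" "q \<in> range const_poly"
    then obtain c d where cd: "p = const_poly c" "q = const_poly d" by blast
    show "\<ominus>\<^bsub>poly_ring V\<^esub> p \<in> range const_poly"
      unfolding cd(1) poly_ring_a_inv[OF poly_ring_const]
      by (auto simp: const_poly_def single_uminus intro!: range_eqI[of _ _ "- c"])
    show "p \<otimes>\<^bsub>poly_ring V\<^esub> q \<in> range const_poly"
      using cd by (auto simp: const_poly_def mult_single intro!: range_eqI[of _ _ "c * d"])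
    show "p \<oplus>\<^bsub>poly_ring V\<^esub> q \<in> range const_poly"
      using cd by (auto simp: const_poly_def single_add intro!: range_eqI[of _ _ "c + d"])
  qed
  show ?thesis
  proof (rule subfieldI)
    show "subcring (range const_poly) (poly_ring V :: ('v, 'k) mpoly ring)"
      by (rule subcringI'[OF sr])
    let ?K = "(poly_ring V :: ('v, 'k) mpoly ring)\<lparr>carrier := range const_poly\<rparr>"
    have "p \<in> Units ?K \<longleftrightarrow> p \<in> range const_poly - {0}" for p
    proof
      assume "p \<in> Units ?K"
      then show "p \<in> range const_poly - {0}" by (auto simp: Units_def)
    next
      assume "p \<in> range const_poly - {0}"
      then obtain c where c: "p = const_poly c" "p \<noteq> 0" by blast
      then have "c \<noteq> 0" by (auto simp: const_poly_def)
      then have "const_poly (inverse c) * p = 1" "p * const_poly (inverse c) = 1"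
        using c(1) by (simp_all add: const_poly_def mult_single)
      then show "p \<in> Units ?K" using c(1) by (auto simp: Units_def)
    qed
    then show "Units ?K = range const_poly - {\<zero>\<^bsub>poly_ring V\<^esub>}" by auto
  qed
qed

text \<open>The monomials outside the ideal are a basis: a linear combination of them lies in the ideal only if
  all of its monomials do, and every polynomial is congruent to such a combination.\<close>

lemma dim_homogeneous_quotient:
  fixes C :: "'v set \<Rightarrow> bool" and I :: "('v, 'k::field) mpoly set"
  assumes I_def: "I = support_ideal V C"
    and V: "finite V" and C: "\<And>A B. C A \<Longrightarrow> A \<subseteq> B \<Longrightarrow> B \<subseteq> V \<Longrightarrow> C B" and C0: "\<not> C {}"
  shows "ring.dim (poly_ring V Quot I) ((\<lambda>a. I +>\<^bsub>poly_ring V\<^esub> const_poly a) ` UNIV)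
      ((\<lambda>p. I +>\<^bsub>poly_ring V\<^esub> p) ` homogeneous_part V d)
    = card {a. Poly_Mapping.keys a \<subseteq> V \<and> monomial_degree a = d \<and> \<not> C (Poly_Mapping.keys a)}"
proof -
  let ?R = "poly_ring V :: ('v, 'k) mpoly ring"
  let ?A = "?R Quot I"
  define h where "h p = I +>\<^bsub>?R\<^esub> p" for p
  have I: "ideal I ?R" unfolding I_def by (rule support_ideal_ideal) (rule C)
  interpret h: ring_hom_ring ?R ?A h
    unfolding h_def by (rule ideal.rcos_ring_hom_ring[OF I])
  have h_eq: "h p = h q \<longleftrightarrow> p - q \<in> I" if "p \<in> carrier ?R" "q \<in> carrier ?R" for p q
    unfolding h_def by (rule coset_eq_iff[OF I that])
  have h0: "\<zero>\<^bsub>?A\<^esub> = h 0" using h.hom_zero by simp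
  have h1: "\<one>\<^bsub>?A\<^esub> = h 1" using h.hom_one by simp
  have h_add: "h (p + q) = h p \<oplus>\<^bsub>?A\<^esub> h q" if "p \<in> carrier ?R" "q \<in> carrier ?R" for p q
    using h.hom_add[OF that] by simp
  have h_mult: "h (p * q) = h p \<otimes>\<^bsub>?A\<^esub> h q" if "p \<in> carrier ?R" "q \<in> carrier ?R" for p q
    using h.hom_mult[OF that] by simp
  define K where "K = h ` range const_poly"
  have "1 \<notin> I" using C0 by (simp add: I_def support_ideal_def)
  then have one_not_zero: "\<one>\<^bsub>?A\<^esub> \<noteq> \<zero>\<^bsub>?A\<^esub>"
    unfolding h0 h1 using h_eq[of 1 0] by (simp add: mem_poly_ring)
  have K: "subfield K ?A"
    unfolding K_def by (rule h.img_is_subfield(2)[OF const_poly_subfield one_not_zero])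
  define mon where "mon a = (Poly_Mapping.single a 1 :: ('v, 'k) mpoly)" for a :: "'v \<Rightarrow>\<^sub>0 nat"
  have mon: "mon a \<in> carrier ?R" if "Poly_Mapping.keys a \<subseteq> V" for a
    unfolding mon_def by (rule poly_ring_single[OF that])
  have in_R: "p \<in> carrier ?R" if "\<And>a. a \<in> S \<Longrightarrow> Poly_Mapping.keys a \<subseteq> V" "Poly_Mapping.keys p \<subseteq> S" for p S
    using that by (fastforce simp: mem_poly_ring)
  have Span: "h.S.Span K (map (\<lambda>a. h (mon a)) as) = h ` {p. Poly_Mapping.keys p \<subseteq> set as}"
    if "\<And>a. a \<in> set as \<Longrightarrow> Poly_Mapping.keys a \<subseteq> V" for as
    using that
  proof (induction as)
    case Nil
    show ?case by (simp add: h0)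
  next
    case (Cons a as)
    have IH: "h.S.Span K (map (\<lambda>a. h (mon a)) as) = h ` {p. Poly_Mapping.keys p \<subseteq> set as}"
      using Cons by simp
    have aV: "Poly_Mapping.keys a \<subseteq> V" using Cons.prems by simp
    have "h.S.Span K (map (\<lambda>a. h (mon a)) (a # as))
        = h.S.line_extension K (h (mon a)) (h ` {p. Poly_Mapping.keys p \<subseteq> set as})"
      using IH by simp
    also have "\<dots> = h ` {p. Poly_Mapping.keys p \<subseteq> set (a # as)}"
    proof (intro equalityI subsetI)
      fix y assume "y \<in> h.S.line_extension K (h (mon a)) (h ` {p. Poly_Mapping.keys p \<subseteq> set as})"
      then obtain c p where cp: "Poly_Mapping.keys p \<subseteq> set as"
        "y = h (const_poly c) \<otimes>\<^bsub>?A\<^esub> h (mon a) \<oplus>\<^bsub>?A\<^esub> h p"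
        unfolding h.S.line_extension_mem_iff K_def by blast
      have p: "p \<in> carrier ?R" using cp(1) Cons.prems by (intro in_R[of "set as"]) auto
      have "y = h (const_poly c * mon a + p)"
        using p mon[OF aV] by (simp add: cp(2) h_add h_mult poly_ring_mult_closed)
      moreover have "Poly_Mapping.keys (const_poly c * mon a + p) \<subseteq> set (a # as)"
        using keys_add[of "const_poly c * mon a" p] cp(1)
        by (auto simp: const_poly_def mon_def mult_single split: if_splits)
      ultimately show "y \<in> h ` {p. Poly_Mapping.keys p \<subseteq> set (a # as)}" by blast
    next
      fix y assume "y \<in> h ` {p. Poly_Mapping.keys p \<subseteq> set (a # as)}"
      then obtain p where p: "Poly_Mapping.keys p \<subseteq> set (a # as)" "y = h p" by blast
      define c where "c = Poly_Mapping.lookup p a"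
      define q where "q = p - const_poly c * mon a"
      have q: "Poly_Mapping.keys q \<subseteq> set as"
      proof
        fix b assume "b \<in> Poly_Mapping.keys q"
        then have "b \<noteq> a" "b \<in> Poly_Mapping.keys p"
          by (auto simp: in_keys_iff q_def c_def const_poly_def mon_def mult_single
              lookup_minus lookup_single when_def split: if_splits)
        then show "b \<in> set as" using p(1) by auto
      qed
      have "q \<in> carrier ?R" using q Cons.prems by (intro in_R[of "set as"]) auto
      then have "y = h (const_poly c) \<otimes>\<^bsub>?A\<^esub> h (mon a) \<oplus>\<^bsub>?A\<^esub> h q"
        using h_add[of "const_poly c * mon a" q] h_mult[of "const_poly c" "mon a"] mon[OF aV] p(2)
        by (simp add: q_def poly_ring_mult_closed)
      then show "y \<in> h.S.line_extension K (h (mon a)) (h ` {p. Poly_Mapping.keys p \<subseteq> set as})"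
        unfolding h.S.line_extension_mem_iff K_def using q by blast
    qed
    finally show ?case .
  qed
  have indep: "h.S.independent K (map (\<lambda>a. h (mon a)) as)"
    if "distinct as" "\<And>a. a \<in> set as \<Longrightarrow> Poly_Mapping.keys a \<subseteq> V \<and> \<not> C (Poly_Mapping.keys a)" for as
    using that
  proof (induction as)
    case (Cons a as)
    have a: "Poly_Mapping.keys a \<subseteq> V" "\<not> C (Poly_Mapping.keys a)" using Cons.prems by auto
    have "h (mon a) \<notin> h ` {p. Poly_Mapping.keys p \<subseteq> set as}"
    proof
      assume "h (mon a) \<in> h ` {p. Poly_Mapping.keys p \<subseteq> set as}"
      then obtain p where p: "Poly_Mapping.keys p \<subseteq> set as" "h (mon a) = h p" by blast
      have "p \<in> carrier ?R" using p(1) Cons.prems by (intro in_R[of "set as"]) auto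
      then have "mon a - p \<in> I" using h_eq[OF mon[OF a(1)]] p(2) by blast
      moreover have "a \<notin> Poly_Mapping.keys p" using p(1) Cons.prems(1) by auto
      then have "a \<in> Poly_Mapping.keys (mon a - p)"
        by (simp add: in_keys_iff mon_def lookup_minus)
      ultimately show False using a(2) by (auto simp: I_def support_ideal_def)
    qed
    then show ?case
      using Cons Span[of as] h.hom_closed[OF mon[OF a(1)]] by (simp del: h.S.Span.simps add: h.S.independent.li_Cons)
  qed simp
  define S where "S = {a. Poly_Mapping.keys a \<subseteq> V \<and> monomial_degree a = d \<and> \<not> C (Poly_Mapping.keys a)}"
  have "finite S"
    by (rule finite_subset[OF _ finite_exponents_of_degree[OF V, of d]]) (auto simp: S_def)
  then obtain as where as: "set as = S" "distinct as" using finite_distinct_list by blast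
  have "h ` homogeneous_part V d = h ` {p. Poly_Mapping.keys p \<subseteq> S}"
  proof (intro equalityI subsetI)
    fix y assume "y \<in> h ` homogeneous_part V d"
    then obtain p where p: "p \<in> carrier ?R" "\<forall>a\<in>Poly_Mapping.keys p. monomial_degree a = d" "y = h p"
      by (auto simp: homogeneous_part_def)
    obtain p0 p1 where p01: "p = p0 + p1" "p1 \<in> support_ideal V C"
      "Poly_Mapping.keys p0 \<subseteq> {a \<in> Poly_Mapping.keys p. \<not> C (Poly_Mapping.keys a)}"
      by (rule support_split[OF p(1)])
    have keys: "Poly_Mapping.keys p0 \<subseteq> S" using p01(3) p(1,2) by (auto simp: S_def mem_poly_ring)
    have "p0 \<in> carrier ?R" using keys by (intro in_R[of S]) (auto simp: S_def)
    then have "h p = h p0" using h_eq[OF p(1), of p0] p01(1,2) by (simp add: I_def)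
    then show "y \<in> h ` {p. Poly_Mapping.keys p \<subseteq> S}" using keys p(3) by auto
  next
    fix y assume "y \<in> h ` {p. Poly_Mapping.keys p \<subseteq> S}"
    then obtain p where p: "Poly_Mapping.keys p \<subseteq> S" "y = h p" by blast
    then have "p \<in> homogeneous_part V d"
      by (fastforce simp: homogeneous_part_def mem_poly_ring S_def)
    then show "y \<in> h ` homogeneous_part V d" using p(2) by blast
  qed
  also have "\<dots> = h.S.Span K (map (\<lambda>a. h (mon a)) as)"
    using Span[of as] as(1) by (simp add: S_def)
  finally have "h.S.dimension (length as) K (h ` homogeneous_part V d)"
    using h.S.dimension_independent[OF indep[of as]] as by (simp add: S_def)
  then have "h.S.dim K (h ` homogeneous_part V d) = length as"
    using h.S.dimI[OF K] by (simp add: over_def)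
  then show ?thesis
    using distinct_card[OF as(2)] as(1) by (simp add: K_def h_def S_def image_image)
qed

section \<open>The Hilbert series of a quotient by a support ideal\<close>

lemma monomial_degree_eq_sum:
  assumes "finite S" "Poly_Mapping.keys a \<subseteq> S"
  shows "monomial_degree a = (\<Sum>v\<in>S. Poly_Mapping.lookup a v)"
  unfolding monomial_degree_def using assms
  by (intro sum.mono_neutral_left) (auto simp: in_keys_iff)

lemma monomial_degree_add_single:
  "monomial_degree (a + Poly_Mapping.single v 1) = Suc (monomial_degree a)"
proof -
  define S where "S = insert v (Poly_Mapping.keys a)"
  have S: "finite S" "v \<in> S" by (simp_all add: S_def)
  have "monomial_degree (a + Poly_Mapping.single v 1)
      = (\<Sum>u\<in>S. Poly_Mapping.lookup (a + Poly_Mapping.single v 1) u)"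
    by (rule monomial_degree_eq_sum[OF S(1)]) (auto simp: S_def keys_exponent_add)
  also have "\<dots> = (\<Sum>u\<in>S. Poly_Mapping.lookup a u) + (\<Sum>u\<in>S. if v = u then 1 else 0)"
    by (simp add: lookup_add lookup_single when_def sum.distrib del: One_nat_def)
  also have "(\<Sum>u\<in>S. Poly_Mapping.lookup a u) = monomial_degree a"
    by (rule monomial_degree_eq_sum[symmetric, OF S(1)]) (auto simp: S_def)
  also have "(\<Sum>u\<in>S. if v = u then 1 else 0) = (1 :: nat)"
    using S by simp
  finally show ?thesis by simp
qed

definition exponents_with_support :: "'v set \<Rightarrow> nat \<Rightarrow> ('v \<Rightarrow>\<^sub>0 nat) set" where
  "exponents_with_support W d = {a. Poly_Mapping.keys a = W \<and> monomial_degree a = d}"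

lemma finite_exponents_with_support: "finite W \<Longrightarrow> finite (exponents_with_support W d)"
  by (rule finite_subset[OF _ finite_exponents_of_degree[where d = d]]) (auto simp: exponents_with_support_def)

text \<open>Removing one factor \<open>v\<close> from a monomial that contains it either keeps the support or drops
  \<open>v\<close> from it. This recursion is the coefficientwise form of the factor \<open>t/(1-t)\<close> for each
  variable of the support.\<close>

lemma exponents_with_support_insert:
  assumes "finite W" "v \<notin> W"
  shows "card (exponents_with_support (insert v W) 0) = 0"
    and "card (exponents_with_support (insert v W) (Suc d))
      = card (exponents_with_support (insert v W) d) + card (exponents_with_support W d)"
proof -
  have "monomial_degree a \<noteq> 0" if "Poly_Mapping.keys a = insert v W" for a
  proof -
    have "v \<in> Poly_Mapping.keys a" using that by simp
    then show ?thesis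
      using monomial_degree_lookup_le[of a v] by (auto simp: in_keys_iff)
  qed
  then have "exponents_with_support (insert v W) 0 = {}"
    by (auto simp: exponents_with_support_def)
  then show "card (exponents_with_support (insert v W) 0) = 0" by simp
  let ?f = "\<lambda>a. a + Poly_Mapping.single v (1::nat)"
  let ?S = "exponents_with_support (insert v W) d" and ?T = "exponents_with_support W d"
  have "exponents_with_support (insert v W) (Suc d) = ?f ` (?S \<union> ?T)"
  proof (intro equalityI subsetI)
    fix a assume "a \<in> exponents_with_support (insert v W) (Suc d)"
    then have a: "Poly_Mapping.keys a = insert v W" "monomial_degree a = Suc d"
      by (simp_all add: exponents_with_support_def)
    define b where "b = a - Poly_Mapping.single v 1"
    have "Poly_Mapping.lookup a v \<noteq> 0" using a(1) in_keys_iff by (metis insertI1)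
    then have ab: "a = ?f b"
      by (intro poly_mapping_eqI) (auto simp: b_def lookup_add lookup_minus lookup_single when_def)
    then have "insert v (Poly_Mapping.keys b) = insert v W"
      using a(1) keys_exponent_add[of b "Poly_Mapping.single v 1"] by simp
    then have "Poly_Mapping.keys b = insert v W \<or> Poly_Mapping.keys b = W"
      using assms(2) by (cases "v \<in> Poly_Mapping.keys b") (auto simp: insert_absorb insert_ident)
    moreover have "monomial_degree b = d"
      using ab a(2) monomial_degree_add_single[of b v] by simp
    ultimately have "b \<in> ?S \<union> ?T" by (auto simp: exponents_with_support_def)
    then show "a \<in> ?f ` (?S \<union> ?T)" using ab by blast
  next
    fix a assume "a \<in> ?f ` (?S \<union> ?T)"
    then obtain b where "b \<in> ?S \<union> ?T" "a = ?f b" by blast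
    then show "a \<in> exponents_with_support (insert v W) (Suc d)"
      using monomial_degree_add_single[of b v]
      by (auto simp: exponents_with_support_def keys_exponent_add)
  qed
  moreover have "inj_on ?f (?S \<union> ?T)" by (rule inj_onI) simp
  moreover have "card (?S \<union> ?T) = card ?S + card ?T"
    using assms by (intro card_Un_disjoint finite_exponents_with_support)
      (auto simp: exponents_with_support_def)
  ultimately show "card (exponents_with_support (insert v W) (Suc d)) = card ?S + card ?T"
    by (simp add: card_image)
qed

lemma exponents_with_support_series:
  fixes W :: "'v set"
  assumes "finite W"
  shows "Abs_fps (\<lambda>d. int (card (exponents_with_support W d))) * (1 - fps_X) ^ card W
    = fps_X ^ card W"
  using assms
proof (induction W)
  case empty
  have "exponents_with_support ({} :: 'v set) d = (if d = 0 then {0} else {})" for d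
    by (auto simp: exponents_with_support_def monomial_degree_def)
  then have "Abs_fps (\<lambda>d. int (card (exponents_with_support ({} :: 'v set) d))) = 1"
    by (intro fps_ext) simp
  then show ?case by simp
next
  case (insert v W)
  let ?G = "\<lambda>W. Abs_fps (\<lambda>d. int (card (exponents_with_support W d)))"
  have "?G (insert v W) * (1 - fps_X) = ?G W * fps_X"
  proof (rule fps_ext)
    fix d show "fps_nth (?G (insert v W) * (1 - fps_X)) d = fps_nth (?G W * fps_X) d"
      using exponents_with_support_insert(1)[OF insert.hyps]
        exponents_with_support_insert(2)[OF insert.hyps, of "d - 1"]
      by (cases d) (simp_all add: right_diff_distrib)
  qed
  note shift = this
  have "?G (insert v W) * (1 - fps_X) ^ card (insert v W)
      = (?G (insert v W) * (1 - fps_X)) * (1 - fps_X) ^ card W"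
    by (simp only: card_insert_disjoint[OF insert.hyps] power_Suc mult.assoc)
  also have "\<dots> = fps_X * (?G W * (1 - fps_X) ^ card W)"
    unfolding shift by (simp only: mult_ac)
  also have "\<dots> = fps_X ^ card (insert v W)"
    by (simp only: insert.IH card_insert_disjoint[OF insert.hyps] power_Suc)
  finally show ?case .
qed

text \<open>Each support contributes \<open>(t/(1-t))^|W|\<close>; this is the sum of these contributions, for the
  supports satisfying \<open>C\<close>, over the common denominator \<open>(1-t)^(|V|-k)\<close>.\<close>

definition numerator_poly :: "'v set \<Rightarrow> nat \<Rightarrow> ('v set \<Rightarrow> bool) \<Rightarrow> int poly" where
  "numerator_poly V k C =
     (\<Sum>W | W \<subseteq> V \<and> C W. [:0, 1:] ^ card W * [:1, - 1:] ^ (card (V - W) - k))"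

lemma hilbert_series_numerator:
  assumes V: "finite V" and k: "\<And>W. W \<subseteq> V \<Longrightarrow> \<not> C W \<Longrightarrow> k \<le> card (V - W)"
  shows "Abs_fps (\<lambda>d. int (card {a. Poly_Mapping.keys a \<subseteq> V \<and> monomial_degree a = d
      \<and> \<not> C (Poly_Mapping.keys a)})) * (1 - fps_X) ^ (card V - k)
    = fps_of_poly (numerator_poly V k (\<lambda>W. \<not> C W))"
proof -
  let ?G = "\<lambda>W. Abs_fps (\<lambda>d. int (card (exponents_with_support W d)))"
  let ?N = "{W. W \<subseteq> V \<and> \<not> C W}"
  have N: "finite ?N" using V by simp
  have fin: "finite W" "card W + card (V - W) = card V" if "W \<in> ?N" for W
    using that V by (auto simp: finite_subset[OF _ V] card_Diff_subset card_mono)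
  have "Abs_fps (\<lambda>d. int (card {a. Poly_Mapping.keys a \<subseteq> V \<and> monomial_degree a = d
      \<and> \<not> C (Poly_Mapping.keys a)})) = (\<Sum>W\<in>?N. ?G W)"
  proof (rule fps_ext)
    fix d
    have "{a. Poly_Mapping.keys a \<subseteq> V \<and> monomial_degree a = d \<and> \<not> C (Poly_Mapping.keys a)}
      = (\<Union>W\<in>?N. exponents_with_support W d)"
      by (auto simp: exponents_with_support_def)
    also have "card \<dots> = (\<Sum>W\<in>?N. card (exponents_with_support W d))"
      by (intro card_UN_disjoint ballI impI finite_exponents_with_support)
        (use N fin(1) in \<open>auto simp: exponents_with_support_def\<close>)
    finally show "fps_nth (Abs_fps (\<lambda>d. int (card {a. Poly_Mapping.keys a \<subseteq> V \<and> monomial_degree a = d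
      \<and> \<not> C (Poly_Mapping.keys a)}))) d = fps_nth (\<Sum>W\<in>?N. ?G W) d"
      by (simp add: fps_sum_nth)
  qed
  also have "\<dots> * (1 - fps_X) ^ (card V - k) = (\<Sum>W\<in>?N. ?G W * (1 - fps_X) ^ (card V - k))"
    by (simp add: sum_distrib_right)
  also have "\<dots> = (\<Sum>W\<in>?N. fps_X ^ card W * (1 - fps_X) ^ (card (V - W) - k))"
  proof (rule sum.cong[OF refl])
    fix W assume W: "W \<in> ?N"
    have "card V - k = card W + (card (V - W) - k)" using fin(2)[OF W] k[of W] W by auto
    then show "?G W * (1 - fps_X) ^ (card V - k) = fps_X ^ card W * (1 - fps_X) ^ (card (V - W) - k)"
      using exponents_with_support_series[OF fin(1)[OF W]] by (simp add: power_add mult.assoc[symmetric])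
  qed
  also have "\<dots> = fps_of_poly (numerator_poly V k (\<lambda>W. \<not> C W))"
  proof -
    have "fps_of_poly [:1, - 1 :: int:] = 1 - fps_X"
      by (simp add: fps_of_poly_pCons)
    then show ?thesis
      by (simp only: numerator_poly_def fps_of_poly_sum fps_of_poly_mult fps_of_poly_power fps_of_poly_fps_X)
  qed
  finally show ?thesis .
qed

text \<open>With \<open>x\<close> as the probability of picking a vertex, this is the total probability of all
  random subsets.\<close>

lemma sum_subsets_weight:
  fixes x y :: "'a::comm_ring_1"
  assumes "finite V" "x + y = 1"
  shows "(\<Sum>W\<in>Pow V. x ^ card W * y ^ card (V - W)) = 1"
  using prod_add[OF assms(1), of "\<lambda>_. x" "\<lambda>_. y"] assms(2) by simp

text \<open>The exponent two makes up for the difference between \<open>|V|\<close> and the Krull dimension. All weights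
  sum to one, which turns the sum over non-covers into one minus the sum over covers.\<close>

lemma cover_h_polynomial_equation:
  assumes G: "simple_graph V E" and E: "E \<noteq> {}"
  shows "quotient_h_polynomial V (cover_ideal V E :: ('v, 'k::field) mpoly set) * [:1, - 1:] ^ 2
    = 1 - (\<Sum>W | vertex_cover V E W. [:0, 1:] ^ card W * [:1, - 1:] ^ card (V - W))"
proof -
  have V: "finite V" using G by (simp add: simple_graph_def)
  let ?I = "support_ideal V (vertex_cover V E) :: ('v, 'k) mpoly set"
  let ?C = "vertex_cover V E"
  let ?f = "numerator_poly V 2 (\<lambda>W. \<not> ?C W)"
  have two: "2 \<le> card (V - W)" if W: "W \<subseteq> V" "\<not> ?C W" for W
  proof -
    obtain e where "e \<in> E" "W \<inter> e = {}" using W by (auto simp: vertex_cover_def)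
    moreover obtain u v where "u \<in> V" "v \<in> V" "u \<noteq> v" "e = {u, v}"
      using G \<open>e \<in> E\<close> by (auto simp: simple_graph_def)
    ultimately have "card {u, v} \<le> card (V - W)" using V by (intro card_mono) auto
    then show ?thesis using \<open>u \<noteq> v\<close> by simp
  qed
  have C0: "\<not> ?C {}" using E by (auto simp: vertex_cover_def)
  have "hilbert_series (poly_ring V Quot ?I) ((\<lambda>a. ?I +>\<^bsub>poly_ring V\<^esub> const_poly a) ` UNIV)
      (\<lambda>d. (\<lambda>p. ?I +>\<^bsub>poly_ring V\<^esub> p) ` homogeneous_part V d)
    = Abs_fps (\<lambda>d. int (card {a. Poly_Mapping.keys a \<subseteq> V \<and> monomial_degree a = d
      \<and> \<not> ?C (Poly_Mapping.keys a)}))"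
    unfolding hilbert_series_def
    using dim_homogeneous_quotient[of ?I V ?C, OF refl V vertex_cover_mono C0] by simp
  then have "quotient_h_polynomial V (cover_ideal V E :: ('v, 'k) mpoly set)
    = (THE h. fps_of_poly h = fps_of_poly ?f)"
    unfolding quotient_h_polynomial_def h_polynomial_def cover_ideal_eq_support_ideal[OF V]
      krull_dim_cover_quotient[OF G E]
    using hilbert_series_numerator[OF V two] by simp
  also have "\<dots> = ?f" by (simp add: fps_of_poly_eq_iff)
  finally have h: "quotient_h_polynomial V (cover_ideal V E :: ('v, 'k) mpoly set) = ?f" .
  let ?w = "\<lambda>W. [:0, 1:] ^ card W * [:1, - 1 :: int:] ^ card (V - W)"
  have "?f * [:1, - 1:] ^ 2 = (\<Sum>W | W \<subseteq> V \<and> \<not> ?C W. ?w W)"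
    unfolding numerator_poly_def sum_distrib_right
  proof (rule sum.cong[OF refl])
    fix W assume "W \<in> {W. W \<subseteq> V \<and> \<not> ?C W}"
    then have "card (V - W) = (card (V - W) - 2) + 2" using two[of W] by simp
    then have "[:1, - 1 :: int:] ^ card (V - W) = [:1, - 1:] ^ (card (V - W) - 2) * [:1, - 1:] ^ 2"
      by (metis power_add)
    then show "[:0, 1:] ^ card W * [:1, - 1:] ^ (card (V - W) - 2) * [:1, - 1:] ^ 2 = ?w W"
      by (simp only: mult.assoc)
  qed
  also have "\<dots> = (\<Sum>W\<in>Pow V. ?w W) - (\<Sum>W | ?C W. ?w W)"
  proof -
    have "Pow V = {W. W \<subseteq> V \<and> \<not> ?C W} \<union> {W. ?C W}" by (auto simp: vertex_cover_def)
    moreover have "finite {W. W \<subseteq> V \<and> \<not> ?C W}" "finite {W. ?C W}"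
      using V by (auto intro: finite_subset[of _ "Pow V"] simp: vertex_cover_def)
    ultimately have "(\<Sum>W\<in>Pow V. ?w W) = (\<Sum>W | W \<subseteq> V \<and> \<not> ?C W. ?w W) + (\<Sum>W | ?C W. ?w W)"
      by (simp only:) (intro sum.union_disjoint; auto)
    then show ?thesis by simp
  qed
  finally show ?thesis using h sum_subsets_weight[OF V, of "[:0, 1:]" "[:1, - 1 :: int:]"] by (simp add: one_pCons)
qed

section \<open>Trees of radius at most two\<close>

lemma graph_dist_walk:
  assumes "connected_graph V E" "u \<in> V" "v \<in> V"
  obtains p where "walk V E u p v" "length p = Suc (graph_dist V E u v)"
proof -
  obtain q where q: "walk V E u q v" using assms by (auto simp: connected_graph_def)
  then have "length q = Suc (length q - 1)" by (cases q) (auto simp: walk_def)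
  then have "\<exists>n p. walk V E u p v \<and> length p = Suc n" using q by blast
  then have "\<exists>p. walk V E u p v \<and> length p = Suc (graph_dist V E u v)"
    unfolding graph_dist_def by (rule LeastI_ex)
  then show thesis using that by blast
qed

lemma graph_dist_le: "walk V E u p v \<Longrightarrow> length p = Suc n \<Longrightarrow> graph_dist V E u v \<le> n"
  unfolding graph_dist_def by (rule Least_le) blast

text \<open>Any further edge would close a cycle of length three, four or five through \<open>c\<close> or through a common
  neighbor.\<close>

lemma radius_two_tree_structure:
  fixes V :: "'v set" and E :: "'v set set" and c :: 'v
  defines "N \<equiv> neighbors V E c" and "D \<equiv> {v \<in> V. graph_dist V E c v = 2}"
  assumes tree: "is_tree V E" and c: "c \<in> V" and dist: "\<forall>v\<in>V. graph_dist V E c v \<le> 2"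
  obtains f where "V = insert c (N \<union> D)" "c \<notin> N" "c \<notin> D" "N \<inter> D = {}" "f ` D \<subseteq> N"
    "E = (\<lambda>a. {c, a}) ` N \<union> (\<lambda>d. {f d, d}) ` D"
proof -
  have G: "simple_graph V E" and conn: "connected_graph V E" and acyclic: "\<And>p. \<not> graph_cycle V E p"
    using tree by (auto simp: is_tree_def)
  have E: "\<exists>u\<in>V. \<exists>v\<in>V. u \<noteq> v \<and> e = {u, v}" if "e \<in> E" for e
    using G that by (auto simp: simple_graph_def)
  have no_loop: "{u, u} \<notin> E" for u
    using E[of "{u, u}"] by (auto simp: doubleton_eq_iff)
  have NV: "N \<subseteq> V" "D \<subseteq> V" by (auto simp: N_def D_def neighbors_def)
  have N_edge: "{c, a} \<in> E" if "a \<in> N" for a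
    using that by (simp add: N_def neighbors_def)
  have cN: "c \<notin> N" using no_loop[of c] by (auto simp: N_def neighbors_def)
  have dist_c: "graph_dist V E c c = 0"
    using graph_dist_le[of V E c "[c]" c 0] c by (simp add: walk_def)
  have dist_N: "graph_dist V E c a \<le> 1" if "a \<in> N" for a
    using graph_dist_le[of V E c "[c, a]" a 1] that c N_edge[OF that] NV by (auto simp: walk_def)
  have cD: "c \<notin> D" using dist_c by (simp add: D_def)
  have ND: "N \<inter> D = {}" using dist_N by (force simp: D_def)
  have D_walk: "\<exists>a\<in>N. {a, v} \<in> E" if "v \<in> D" for v
  proof -
    have v: "v \<in> V" using that NV by blast
    obtain p where p: "walk V E c p v" "length p = Suc (graph_dist V E c v)"
      by (rule graph_dist_walk[OF conn c v])
    have "length p = Suc (Suc (Suc 0))" using p(2) that by (simp add: D_def)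
    then obtain x y z where "p = [x, y, z]" by (auto simp: length_Suc_conv)
    then show ?thesis using p(1) by (auto simp: walk_def N_def neighbors_def)
  qed
  have V_eq: "V = insert c (N \<union> D)"
  proof (intro equalityI subsetI)
    fix v assume v: "v \<in> V"
    obtain p where p: "walk V E c p v" "length p = Suc (graph_dist V E c v)"
      by (rule graph_dist_walk[OF conn c v])
    consider "graph_dist V E c v = 0" | "graph_dist V E c v = 1" | "graph_dist V E c v = 2"
      using dist v by force
    then show "v \<in> insert c (N \<union> D)"
    proof cases
      case 1
      then obtain x where "p = [x]" using p(2) by (auto simp: length_Suc_conv)
      then show ?thesis using p(1) by (auto simp: walk_def)
    next
      case 2
      then obtain x y where "p = [x, y]" using p(2) by (auto simp: length_Suc_conv)
      then show ?thesis using p(1) by (auto simp: walk_def N_def neighbors_def)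
    next
      case 3
      then show ?thesis using v by (simp add: D_def)
    qed
  qed (use c NV in auto)
  obtain f where f: "\<And>d. d \<in> D \<Longrightarrow> f d \<in> N" "\<And>d. d \<in> D \<Longrightarrow> {f d, d} \<in> E"
    using D_walk by metis
  have no_NN: "{a, b} \<notin> E" if "a \<in> N" "b \<in> N" for a b
  proof
    assume ab: "{a, b} \<in> E"
    then have "a \<noteq> b" using no_loop by auto
    then have "graph_cycle V E [c, a, b]"
      using that ab cN c NV N_edge[OF that(1)] N_edge[OF that(2)]
      by (auto simp: graph_cycle_def walk_def insert_commute)
    then show False using acyclic by blast
  qed
  have ND_edge: "a = f d" if "a \<in> N" "d \<in> D" "{a, d} \<in> E" for a d
  proof (rule ccontr)
    assume "a \<noteq> f d"
    then have "graph_cycle V E [c, a, d, f d]"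
      using that f[OF that(2)] cN cD c NV ND N_edge[OF that(1)] N_edge[OF f(1)[OF that(2)]]
      by (auto simp: graph_cycle_def walk_def insert_commute)
    then show False using acyclic by blast
  qed
  have no_DD: "{d, d'} \<notin> E" if dd: "d \<in> D" "d' \<in> D" for d d'
  proof
    assume edge: "{d, d'} \<in> E"
    then have ne: "d \<noteq> d'" using no_loop by auto
    note fd = f[OF dd(1)] f[OF dd(2)]
    have out: "f d \<noteq> d" "f d \<noteq> d'" "f d' \<noteq> d" "f d' \<noteq> d'" "c \<noteq> d" "c \<noteq> d'" "c \<noteq> f d" "c \<noteq> f d'"
      using fd dd ND cN cD by auto
    have inV: "d \<in> V" "d' \<in> V" "f d \<in> V" "f d' \<in> V" using dd fd NV by auto
    \<comment> \<open>A triangle at the common neighbor, or a cycle of length five through \<open>c\<close>.\<close>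
    have "graph_cycle V E (if f d = f d' then [f d, d, d'] else [c, f d, d, d', f d'])"
      using edge ne fd out inV c N_edge[OF fd(1)] N_edge[OF fd(3)]
      by (auto simp: graph_cycle_def walk_def insert_commute)
    then show False using acyclic by blast
  qed
  have "E \<subseteq> (\<lambda>a. {c, a}) ` N \<union> (\<lambda>d. {f d, d}) ` D"
  proof
    fix e assume e: "e \<in> E"
    then obtain u v where uv: "u \<in> V" "v \<in> V" "u \<noteq> v" "e = {u, v}" using E by blast
    have main: "{u, v} \<in> (\<lambda>a. {c, a}) ` N \<union> (\<lambda>d. {f d, d}) ` D"
      if "u \<in> V" "v \<in> V" "{u, v} \<in> E" "u = c \<or> u \<in> N \<and> v \<in> D" for u v
      using that ND_edge[of u v] by (auto simp: N_def neighbors_def)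
    have "u = c \<or> v = c \<or> u \<in> N \<and> v \<in> D \<or> v \<in> N \<and> u \<in> D"
      using uv e no_NN[of u v] no_DD[of u v] V_eq by auto
    then show "e \<in> (\<lambda>a. {c, a}) ` N \<union> (\<lambda>d. {f d, d}) ` D"
      using main[of u v] main[of v u] uv e by (auto simp: insert_commute)
  qed
  then have "E = (\<lambda>a. {c, a}) ` N \<union> (\<lambda>d. {f d, d}) ` D"
    using N_edge f(2) by blast
  then show thesis using that V_eq cN cD ND f(1) by blast
qed

section \<open>Weighted count of vertex covers\<close>

text \<open>Membership of the elements outside \<open>F\<close> is free, so their weights sum to one.\<close>

lemma sum_supersets_weight:
  fixes x y :: "'a::comm_ring_1"
  assumes A: "finite A" "F \<subseteq> A" and xy: "x + y = 1"
  shows "(\<Sum>Z | F \<subseteq> Z \<and> Z \<subseteq> A. x ^ card Z * y ^ card (A - Z)) = x ^ card F"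
proof -
  have "(\<Sum>Z | F \<subseteq> Z \<and> Z \<subseteq> A. x ^ card Z * y ^ card (A - Z))
    = (\<Sum>Y\<in>Pow (A - F). x ^ card F * (x ^ card Y * y ^ card ((A - F) - Y)))"
  proof (rule sum.reindex_bij_witness[where i = "\<lambda>Y. F \<union> Y" and j = "\<lambda>Z. Z - F"])
    fix Z assume Z: "Z \<in> {Z. F \<subseteq> Z \<and> Z \<subseteq> A}"
    have "finite Z" "finite F" using Z A finite_subset[of _ A] by auto
    then have "card Z = card F + card (Z - F)"
      using Z by (auto simp: card_Diff_subset card_mono)
    moreover have "(A - F) - (Z - F) = A - Z" using Z by blast
    ultimately show "x ^ card F * (x ^ card (Z - F) * y ^ card ((A - F) - (Z - F)))
        = x ^ card Z * y ^ card (A - Z)"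
      by (simp add: power_add mult.assoc)
  qed (use A in auto)
  also have "\<dots> = x ^ card F"
    using sum_subsets_weight[of "A - F" x y] A xy by (simp flip: sum_distrib_left)
  finally show ?thesis .
qed

text \<open>A cover without \<open>c\<close> must contain all neighbors, and then any vertices at distance two
  are allowed. A cover with \<open>c\<close> contains an arbitrary set \<open>U\<close> of neighbors, together with at
  least the pendant vertices \<open>d\<close> attached outside \<open>U\<close>; summing over \<open>U\<close> gives the expanded product.\<close>

lemma sum_vertex_covers_weight:
  fixes x y :: "'a::comm_ring_1" and f :: "'v \<Rightarrow> 'v"
  assumes fin: "finite N" "finite D"
    and V: "V = insert c (N \<union> D)" and disj: "c \<notin> N" "c \<notin> D" "N \<inter> D = {}" and f: "f ` D \<subseteq> N"
    and E: "E = (\<lambda>a. {c, a}) ` N \<union> (\<lambda>d. {f d, d}) ` D"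
    and xy: "x + y = 1"
  shows "(\<Sum>W | vertex_cover V E W. x ^ card W * y ^ card (V - W))
    = x * (\<Prod>a\<in>N. x + y * x ^ card {d \<in> D. f d = a}) + y * x ^ card N"
proof -
  let ?w = "\<lambda>A W. x ^ card W * y ^ card (A - W)"
  have cover: "vertex_cover V E W \<longleftrightarrow> W \<subseteq> V \<and> (c \<in> W \<or> N \<subseteq> W) \<and> (\<forall>d\<in>D. d \<in> W \<or> f d \<in> W)" for W
  proof -
    have meet: "W \<inter> {a, b} \<noteq> {} \<longleftrightarrow> a \<in> W \<or> b \<in> W" for a b by blast
    show ?thesis
      unfolding vertex_cover_def E ball_Un ball_simps meet by blast
  qed
  define F where "F U = {d \<in> D. f d \<notin> U}" for U
  have finV: "finite V" using V fin by simp
  have finC: "finite {W. vertex_cover V E W \<and> P W}" for P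
    by (rule finite_subset[of _ "Pow V"]) (use finV in \<open>auto simp: vertex_cover_def\<close>)
  have split: "{W. vertex_cover V E W} = {W. vertex_cover V E W \<and> c \<in> W} \<union> {W. vertex_cover V E W \<and> c \<notin> W}"
    by blast
  have "{W. vertex_cover V E W \<and> c \<in> W} \<inter> {W. vertex_cover V E W \<and> c \<notin> W} = {}"
    by blast
  from sum.union_disjoint[OF finC finC this, of "?w V", folded split]
  have "(\<Sum>W | vertex_cover V E W. ?w V W)
    = (\<Sum>W | vertex_cover V E W \<and> c \<in> W. ?w V W) + (\<Sum>W | vertex_cover V E W \<and> c \<notin> W. ?w V W)" .
  also have "(\<Sum>W | vertex_cover V E W \<and> c \<notin> W. ?w V W) = (\<Sum>W | N \<subseteq> W \<and> W \<subseteq> N \<union> D. y * ?w (N \<union> D) W)"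
  proof (rule sum.cong)
    show "{W. vertex_cover V E W \<and> c \<notin> W} = {W. N \<subseteq> W \<and> W \<subseteq> N \<union> D}"
      unfolding cover unfolding V using disj f by auto
    fix W assume "W \<in> {W. N \<subseteq> W \<and> W \<subseteq> N \<union> D}"
    then have "V - W = insert c (N \<union> D - W)" using disj by (auto simp: V)
    then show "?w V W = y * ?w (N \<union> D) W"
      using fin disj by (simp add: mult.left_commute)
  qed
  also have "\<dots> = y * x ^ card N"
    using sum_supersets_weight[of "N \<union> D" N x y] fin xy by (simp flip: sum_distrib_left)
  also have "(\<Sum>W | vertex_cover V E W \<and> c \<in> W. ?w V W)
    = (\<Sum>(U, Z)\<in>Sigma (Pow N) (\<lambda>U. {Z. F U \<subseteq> Z \<and> Z \<subseteq> D}). x * (?w N U * ?w D Z))"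
  proof (rule sum.reindex_bij_witness[where i = "\<lambda>(U, Z). insert c (U \<union> Z)" and j = "\<lambda>W. (W \<inter> N, W \<inter> D)"])
    fix W assume "W \<in> {W. vertex_cover V E W \<and> c \<in> W}"
    then have W: "W \<subseteq> V" "c \<in> W" "\<forall>d\<in>D. d \<in> W \<or> f d \<in> W" by (auto simp: cover)
    show "(case (W \<inter> N, W \<inter> D) of (U, Z) \<Rightarrow> insert c (U \<union> Z)) = W"
      using W by (auto simp: V)
    show "(W \<inter> N, W \<inter> D) \<in> Sigma (Pow N) (\<lambda>U. {Z. F U \<subseteq> Z \<and> Z \<subseteq> D})"
      using W f by (auto simp: F_def)
    have "W = insert c ((W \<inter> N) \<union> (W \<inter> D))" using W by (auto simp: V)
    then have "card W = card (insert c ((W \<inter> N) \<union> (W \<inter> D)))" by simp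
    also have "\<dots> = Suc (card (W \<inter> N) + card (W \<inter> D))"
      using fin disj by (subst card_insert_disjoint, simp, simp, subst card_Un_disjoint) auto
    finally have 1: "card W = Suc (card (W \<inter> N) + card (W \<inter> D))" .
    have "V - W = (N - W \<inter> N) \<union> (D - W \<inter> D)" using W by (auto simp: V)
    then have "card (V - W) = card ((N - W \<inter> N) \<union> (D - W \<inter> D))" by simp
    also have "\<dots> = card (N - W \<inter> N) + card (D - W \<inter> D)"
      using fin disj by (intro card_Un_disjoint) auto
    finally show "(case (W \<inter> N, W \<inter> D) of (U, Z) \<Rightarrow> x * (?w N U * ?w D Z)) = ?w V W"
      using 1 by (simp add: power_add mult_ac)
  next
    fix UZ assume "UZ \<in> Sigma (Pow N) (\<lambda>U. {Z. F U \<subseteq> Z \<and> Z \<subseteq> D})"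
    then obtain U Z where UZ: "UZ = (U, Z)" "U \<subseteq> N" "F U \<subseteq> Z" "Z \<subseteq> D" by auto
    show "(case UZ of (U, Z) \<Rightarrow> insert c (U \<union> Z)) \<in> {W. vertex_cover V E W \<and> c \<in> W}"
      unfolding cover unfolding V UZ(1) using UZ(2-) by (auto simp: F_def)
    have "insert c (U \<union> Z) \<inter> N = U" "insert c (U \<union> Z) \<inter> D = Z"
      using UZ(2,4) disj by blast+
    then show "((case UZ of (U, Z) \<Rightarrow> insert c (U \<union> Z)) \<inter> N, (case UZ of (U, Z) \<Rightarrow> insert c (U \<union> Z)) \<inter> D) = UZ"
      using UZ(1) by simp
  qed
  also have "\<dots> = (\<Sum>U\<in>Pow N. \<Sum>Z | F U \<subseteq> Z \<and> Z \<subseteq> D. x * (?w N U * ?w D Z))"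
    using fin by (subst sum.Sigma) (auto intro: finite_subset[of _ "Pow D"])
  also have "\<dots> = (\<Sum>U\<in>Pow N. x * (?w N U * x ^ card (F U)))"
  proof (rule sum.cong[OF refl])
    fix U
    have "F U \<subseteq> D" by (auto simp: F_def)
    then show "(\<Sum>Z | F U \<subseteq> Z \<and> Z \<subseteq> D. x * (?w N U * ?w D Z)) = x * (?w N U * x ^ card (F U))"
      using sum_supersets_weight[OF fin(2) _ xy] by (simp flip: sum_distrib_left)
  qed
  also have "\<dots> = x * (\<Sum>U\<in>Pow N. (\<Prod>a\<in>U. x) * (\<Prod>a\<in>N - U. y * x ^ card {d \<in> D. f d = a}))"
    unfolding sum_distrib_left
  proof (rule sum.cong[OF refl])
    fix U assume "U \<in> Pow N"
    have "F U = (\<Union>a\<in>N - U. {d \<in> D. f d = a})" using f by (auto simp: F_def)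
    then have "card (F U) = (\<Sum>a\<in>N - U. card {d \<in> D. f d = a})"
      using fin by (simp, intro card_UN_disjoint) auto
    then show "x * (?w N U * x ^ card (F U)) = x * ((\<Prod>a\<in>U. x) * (\<Prod>a\<in>N - U. y * x ^ card {d \<in> D. f d = a}))"
      by (simp add: power_sum prod.distrib mult.assoc)
  qed
  also have "\<dots> = x * (\<Prod>a\<in>N. x + y * x ^ card {d \<in> D. f d = a})"
    by (simp only: prod_add[OF fin(1)])
  finally show ?thesis .
qed

section \<open>Degree of the numerator\<close>

lemma coeff_star_factor_mult:
  fixes P :: "int poly"
  shows "Polynomial.coeff (([:0, 1:] + [:1, - 1:] * [:0, 1:] ^ s) * P) i =
    (if i = 0 then 0 else Polynomial.coeff P (i - 1)) + (if i < s then 0 else Polynomial.coeff P (i - s))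
    - (if i < s + 1 then 0 else Polynomial.coeff P (i - (s + 1)))"
proof -
  have "[:0, 1:] + [:1, - 1:] * [:0, 1:] ^ s
    = Polynomial.monom 1 1 + Polynomial.monom 1 s - Polynomial.monom (1 :: int) (s + 1)"
    by (simp add: monom_altdef algebra_simps)
  then show ?thesis
    by (simp add: distrib_right left_diff_distrib coeff_monom_mult)
qed

text \<open>With \<open>1 \<le> s a\<close>, each factor is \<open>- t^(s a + 1) + t^(s a) + t\<close>, where the last two terms
  coincide in degree if \<open>s a = 1\<close>. The subleading coefficient of the product thus depends on the
  number of \<open>a\<close> with \<open>s a = 1\<close>, but its sign is fixed and each factor contributes at least one
  to its absolute value.\<close>

lemma star_product_coeffs:
  fixes s :: "'a \<Rightarrow> nat"
  defines "P \<equiv> \<lambda>M. [:0, 1:] * (\<Prod>a\<in>M. [:0, 1:] + [:1, - 1 :: int:] * [:0, 1:] ^ s a)"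
  assumes "finite M" "\<And>a. a \<in> M \<Longrightarrow> 1 \<le> s a"
  shows "\<forall>i>(\<Sum>a\<in>M. s a) + card M + 1. Polynomial.coeff (P M) i = 0"
    and "Polynomial.coeff (P M) ((\<Sum>a\<in>M. s a) + card M + 1) = (- 1) ^ card M"
    and "(- 1) ^ card M * Polynomial.coeff (P M) ((\<Sum>a\<in>M. s a) + card M) \<le> - int (card M)"
proof -
  have "(\<forall>i>(\<Sum>a\<in>M. s a) + card M + 1. Polynomial.coeff (P M) i = 0)
    \<and> Polynomial.coeff (P M) ((\<Sum>a\<in>M. s a) + card M + 1) = (- 1) ^ card M
    \<and> (- 1) ^ card M * Polynomial.coeff (P M) ((\<Sum>a\<in>M. s a) + card M) \<le> - int (card M)"
    using assms(2,3)
  proof (induction M)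
    case empty
    then show ?case by (auto simp: P_def coeff_pCons split: nat.split)
  next
    case (insert b M)
    define n where "n = (\<Sum>a\<in>M. s a) + card M"
    have IH: "\<forall>i>n + 1. Polynomial.coeff (P M) i = 0" "Polynomial.coeff (P M) (n + 1) = (- 1) ^ card M"
      "(- 1) ^ card M * Polynomial.coeff (P M) n \<le> - int (card M)"
      using insert.IH insert.prems by (simp_all add: n_def)
    have b: "1 \<le> s b" using insert.prems by simp
    have n': "(\<Sum>a\<in>insert b M. s a) + card (insert b M) = n + s b + 1"
      using insert.hyps by (simp add: n_def)
    have P: "P (insert b M) = ([:0, 1:] + [:1, - 1:] * [:0, 1:] ^ s b) * P M"
      unfolding P_def prod.insert[OF insert.hyps] by (simp only: mult_ac)
    have "\<forall>i>n + s b + 2. Polynomial.coeff (P (insert b M)) i = 0"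
      unfolding P coeff_star_factor_mult using IH(1) b by auto
    moreover have "Polynomial.coeff (P (insert b M)) (n + s b + 2) = (- 1) ^ Suc (card M)"
      unfolding P coeff_star_factor_mult using IH(1,2) b by auto
    moreover have "(- 1) ^ Suc (card M) * Polynomial.coeff (P (insert b M)) (n + s b + 1) \<le> - int (Suc (card M))"
    proof -
      have "Polynomial.coeff (P (insert b M)) (n + s b + 1)
        = (if s b = 1 then (- 1) ^ card M else 0) + (- 1) ^ card M - Polynomial.coeff (P M) n"
        unfolding P coeff_star_factor_mult using IH(1,2) b by auto
      then show ?thesis using IH(3) by (cases "even (card M)") auto
    qed
    ultimately show ?case unfolding n' using insert.hyps by simp
  qed
  then show "\<forall>i>(\<Sum>a\<in>M. s a) + card M + 1. Polynomial.coeff (P M) i = 0"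
    "Polynomial.coeff (P M) ((\<Sum>a\<in>M. s a) + card M + 1) = (- 1) ^ card M"
    "(- 1) ^ card M * Polynomial.coeff (P M) ((\<Sum>a\<in>M. s a) + card M) \<le> - int (card M)"
    by blast+
qed

lemma degree_eqI:
  fixes p :: "'a::zero poly"
  assumes "\<forall>i>n. Polynomial.coeff p i = 0" "Polynomial.coeff p n \<noteq> 0"
  shows "Polynomial.degree p = n"
  using assms by (intro antisym degree_le le_degree)

theorem corollary5p8:
  fixes V :: "'v set" and E :: "'v set set" and c :: 'v
    and B L1 L2 m :: nat
    and J :: "('v, 'k::field) mpoly set"
    and h :: "int poly"
  assumes tree: "is_tree V E"
    and edge: "E \<noteq> {}"
    and center: "c \<in> V" "\<forall>v\<in>V. graph_dist V E c v \<le> 2"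
    and B: "B = graph_degree V E c"
    and L1: "L1 = card {v \<in> neighbors V E c. is_leaf V E v}"
    and m: "m = B - L1"
    and L2: "L2 = card {v \<in> V. graph_dist V E c v = 2}"
    and J: "J = cover_ideal V E"
    and h: "h = quotient_h_polynomial V J"
  shows
    "(L2 = 0 \<longrightarrow> int (degree h) = int B - 1) \<and>
     (L1 = 0 \<longrightarrow> int (degree h) = int B + int L2 - 1) \<and>
     (L1 > 0 \<and> L1 \<noteq> L2 \<longrightarrow> int (degree h) = int m + int (max L1 L2) - 1) \<and>
     (L1 = L2 \<and> L2 > 0 \<and> odd m \<longrightarrow> int (degree h) = int B - 1) \<and>
     (L1 = L2 \<and> L2 > 0 \<and> even m \<longrightarrow> int (degree h) = int B - 2)"
proof -
  have simple: "simple_graph V E" using tree by (simp add: is_tree_def)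
  then have V: "finite V" by (simp add: simple_graph_def)
  define N where "N = neighbors V E c"
  define D where "D = {v \<in> V. graph_dist V E c v = 2}"
  obtain f where st: "V = insert c (N \<union> D)" "c \<notin> N" "c \<notin> D" "N \<inter> D = {}" "f ` D \<subseteq> N"
    "E = (\<lambda>a. {c, a}) ` N \<union> (\<lambda>d. {f d, d}) ` D"
    unfolding N_def D_def by (rule radius_two_tree_structure[OF tree center])
  have fin: "finite N" "finite D" using V st(1) by simp_all
  define s where "s a = card {d \<in> D. f d = a}" for a
  define M where "M = {a \<in> N. 1 \<le> s a}"
  have leaf: "is_leaf V E a \<longleftrightarrow> s a = 0" if a: "a \<in> N" for a
  proof -
    have "neighbors V E a = insert c {d \<in> D. f d = a}"
    proof (intro equalityI subsetI)
      fix x assume "x \<in> neighbors V E a"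
      then have "{a, x} \<in> E" by (simp add: neighbors_def)
      then show "x \<in> insert c {d \<in> D. f d = a}"
        using a st(2-5) unfolding st(6) by (auto simp: doubleton_eq_iff)
    next
      fix x assume "x \<in> insert c {d \<in> D. f d = a}"
      then have "x \<in> V" "{a, x} \<in> E"
        using a unfolding st(6) by (auto simp: st(1) insert_commute)
      then show "x \<in> neighbors V E a" by (simp add: neighbors_def)
    qed
    then have "graph_degree V E a = Suc (s a)"
      using fin st(3) by (simp add: graph_degree_def s_def)
    then show ?thesis using a st(1) by (simp add: is_leaf_def)
  qed
  have B_card: "B = card N" by (simp add: B graph_degree_def N_def)
  have L2_card: "L2 = card D" by (simp add: L2 D_def)
  have N_split: "N = M \<union> {a \<in> N. s a = 0}" "M \<inter> {a \<in> N. s a = 0} = {}" by (auto simp: M_def)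
  have finM: "finite M" using fin by (simp add: M_def)
  have "L1 = card {a \<in> N. s a = 0}"
    unfolding L1 N_def[symmetric] using leaf by (intro arg_cong[of _ _ card]) auto
  then have B_eq: "B = card M + L1"
    unfolding B_card using card_Un_disjoint[OF finM _ N_split(2)] fin(1) N_split(1) by simp
  then have m_card: "m = card M" by (simp add: m)
  have "D = (\<Union>a\<in>N. {d \<in> D. f d = a})" using st(5) by auto
  then have "card D = (\<Sum>a\<in>N. s a)"
    unfolding s_def using card_UN_disjoint[OF fin(1), of "\<lambda>a. {d \<in> D. f d = a}"] fin(2) by auto
  also have "\<dots> = (\<Sum>a\<in>M. s a)"
    using fin(1) by (intro sum.mono_neutral_right) (auto simp: M_def)
  finally have L2_sum: "(\<Sum>a\<in>M. s a) = L2" by (simp add: L2_card)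
  have "card M \<le> (\<Sum>a\<in>M. s a)"
    using sum_mono[of M "\<lambda>_. 1" s] by (simp add: M_def)
  then have m_le: "m \<le> L2" by (simp add: m_card L2_sum)
  have m_pos: "0 < m" if "0 < L2"
  proof -
    have "M \<noteq> {}" using that L2_sum by auto
    then show ?thesis using finM by (simp add: m_card card_gt_0_iff)
  qed
  have "N \<noteq> {}" using edge st(5) unfolding st(6) by auto
  then have B_pos: "0 < B" using fin by (simp add: B_card card_gt_0_iff)
  define P where "P = [:0, 1:] * (\<Prod>a\<in>M. [:0, 1:] + [:1, - 1 :: int:] * [:0, 1:] ^ s a)"
  define Q where "Q = 1 - (P + [:1, - 1:] * [:0, 1:] ^ B)"
  \<comment> \<open>A leaf \<open>a\<close> has \<open>s a = 0\<close> and contributes the factor \<open>t + (1 - t) = 1\<close>.\<close>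
  have "(\<Prod>a\<in>N. [:0, 1:] + [:1, - 1 :: int:] * [:0, 1:] ^ s a)
    = (\<Prod>a\<in>M. [:0, 1:] + [:1, - 1:] * [:0, 1:] ^ s a)"
  proof (rule prod.mono_neutral_right[OF fin(1)])
    show "\<forall>a\<in>N - M. [:0, 1:] + [:1, - 1 :: int:] * [:0, 1:] ^ s a = 1"
    proof
      fix a assume "a \<in> N - M"
      then have "s a = 0" by (auto simp: M_def)
      then show "[:0, 1:] + [:1, - 1 :: int:] * [:0, 1:] ^ s a = 1" by (simp add: one_pCons)
    qed
  qed (auto simp: M_def)
  then have hQ: "h * [:1, - 1:] ^ 2 = Q"
    unfolding h J cover_h_polynomial_equation[OF simple edge] Q_def P_def B_card
    using sum_vertex_covers_weight[OF fin st, of "[:0, 1:]" "[:1, - 1 :: int:]"]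
    by (simp add: one_pCons s_def)
  have deg: "Polynomial.degree h + 2 = K"
    if "\<forall>i>K. Polynomial.coeff Q i = 0" "Polynomial.coeff Q K \<noteq> 0" for K
  proof -
    have "Q \<noteq> 0" using that(2) by auto
    then have "h \<noteq> 0" using hQ by auto
    then have "Polynomial.degree Q = Polynomial.degree h + Polynomial.degree ([:1, - 1 :: int:] ^ 2)"
      unfolding hQ[symmetric] by (intro degree_mult_eq) simp_all
    also have "Polynomial.degree ([:1, - 1 :: int:] ^ 2) = 2"
      by (simp add: degree_power_eq)
    finally show ?thesis using degree_eqI[OF that] by simp
  qed
  note star = star_product_coeffs[OF finM, of s, folded P_def, unfolded L2_sum m_card[symmetric]]
  have M1: "\<And>a. a \<in> M \<Longrightarrow> 1 \<le> s a" by (simp add: M_def)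
  have P_coeff: "\<forall>i>L2 + m + 1. Polynomial.coeff P i = 0" "Polynomial.coeff P (L2 + m + 1) = (- 1) ^ m"
    "(- 1) ^ m * Polynomial.coeff P (L2 + m) \<le> - int m"
    using star M1 by blast+
  have Q_coeff: "Polynomial.coeff Q i = (if i = B + 1 then 1 else 0) - (if i = B then 1 else 0)
    - Polynomial.coeff P i" if "0 < i" for i
  proof -
    have "[:1, - 1:] * [:0, 1:] ^ B = Polynomial.monom 1 B - Polynomial.monom (1 :: int) (B + 1)"
      by (simp add: monom_altdef algebra_simps)
    then show ?thesis using that by (simp add: Q_def)
  qed
  have B_eq': "B = m + L1" using B_eq m_card by simp
  have neq: "Polynomial.degree h + 2 = m + max L1 L2 + 1" if "L1 \<noteq> L2"
  proof (rule deg)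
    show "\<forall>i>m + max L1 L2 + 1. Polynomial.coeff Q i = 0"
      using P_coeff(1) B_eq' by (auto simp: Q_coeff)
    show "Polynomial.coeff Q (m + max L1 L2 + 1) \<noteq> 0"
    proof (cases "L1 < L2")
      case True
      then show ?thesis using P_coeff(2) B_eq' by (simp add: Q_coeff add.commute)
    next
      case False
      then show ?thesis using that P_coeff(1) B_eq' by (simp add: Q_coeff)
    qed
  qed
  have eq_odd: "Polynomial.degree h + 2 = B + 1" if "L1 = L2" "odd m"
  proof (rule deg)
    show "\<forall>i>B + 1. Polynomial.coeff Q i = 0"
      using P_coeff(1) B_eq' that by (auto simp: Q_coeff)
    show "Polynomial.coeff Q (B + 1) \<noteq> 0"
      using P_coeff(2) B_eq' that by (simp add: Q_coeff add.commute)
  qed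
  have eq_even: "Polynomial.degree h + 2 = B" if "L1 = L2" "even m" "0 < L2"
  proof (rule deg)
    \<comment> \<open>The leading coefficients cancel. At \<open>B\<close>, the summand \<open>P\<close> contributes at least \<open>m \<ge> 2\<close>
      to \<open>Q\<close>, the other one only \<open>- 1\<close>.\<close>
    have top: "Polynomial.coeff Q (B + 1) = 0"
      using P_coeff(2) B_eq' that by (simp add: Q_coeff add.commute)
    show "\<forall>i>B. Polynomial.coeff Q i = 0"
    proof (intro allI impI)
      fix i assume "B < i"
      then consider "i = B + 1" | "i > B + 1" by linarith
      then show "Polynomial.coeff Q i = 0"
        using top P_coeff(1) B_eq' that by cases (auto simp: Q_coeff)
    qed
    have "2 \<le> m" using m_pos that by presburger
    moreover have "Polynomial.coeff P B \<le> - int m"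
      using P_coeff(3) B_eq' that by (simp add: add.commute)
    ultimately show "Polynomial.coeff Q B \<noteq> 0"
      using B_pos by (simp add: Q_coeff)
  qed
  have no_leaf: "m = B \<and> 0 < L2" if "L1 = 0"
    using that B_eq' B_pos m_le by auto
  have star_case: "m = 0 \<and> L1 = B" if "L2 = 0"
    using that m_le B_eq' by auto
  show ?thesis
  proof (intro conjI impI)
    show "int (Polynomial.degree h) = int B - 1" if "L2 = 0"
      using neq star_case[OF that] that B_pos by simp
    show "int (Polynomial.degree h) = int B + int L2 - 1" if "L1 = 0"
      using neq no_leaf[OF that] that by simp
    show "int (Polynomial.degree h) = int m + int (max L1 L2) - 1" if "L1 > 0 \<and> L1 \<noteq> L2"
      using neq that by simp
    show "int (Polynomial.degree h) = int B - 1" if "L1 = L2 \<and> L2 > 0 \<and> odd m"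
      using eq_odd that by simp
    show "int (Polynomial.degree h) = int B - 2" if "L1 = L2 \<and> L2 > 0 \<and> even m"
      using eq_even that by simp
  qed
qed

end
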